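(* For each integer $m\ge1$ the function $Li_m(z,c)=\sum_{k=0}^\infty\frac{z^{k+1}}{(k+c)^m}$ (defined for $|z|<1$, $\Re c>0$) has a meromorphic continuation in the two variables $(z,c)$ to $\tilde{\mathbb C}_{0,1,\infty}\times\mathbb C$, where $\tilde{\mathbb C}_{0,1,\infty}$ is the universal cover of $\mathbb P^1(\mathbb C)\setminus\{0,1,\infty\}$. For fixed $\tilde z\in\tilde{\mathbb C}_{0,1,\infty}$ this function is meromorphic in $c\in\mathbb C$, and its singularities are exactly poles of exact order $m$ at each point $c\in\mathbb Z_{\le0}$.
   Context: $(k+c)^m$ is an ordinary integer power. The universal cover of $\mathbb P^1(\mathbb C)\setminus\{0,1,\infty\}$ is taken with base point $z=-1$ (or any point of the unit disk minus $\{0\}$), from which the series is continued. *)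

theory Defs
  imports "HOL-Complex_Analysis.Complex_Analysis"
begin

text \<open>The Lerch-type polylogarithm, given by its series (meant for norm z < 1, Re c > 0).\<close>
definition Li :: "nat \<Rightarrow> complex \<Rightarrow> complex \<Rightarrow> complex" where
  "Li m z c = (\<Sum>k. z ^ (k + 1) / (of_nat k + c) ^ m)"

definition holomorphic2 :: "(complex \<times> complex \<Rightarrow> complex) \<Rightarrow> (complex \<times> complex) set \<Rightarrow> bool" where
  "holomorphic2 f S \<longleftrightarrow>
     (\<forall>p\<in>S. \<exists>a b. (f has_derivative (\<lambda>(u, v). a * u + b * v)) (at p))"

definition meromorphic2 :: "(complex \<times> complex \<Rightarrow> complex) \<Rightarrow> (complex \<times> complex) set \<Rightarrow> bool" where
  "meromorphic2 f S \<longleftrightarrow> open S \<and>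
     (\<forall>p\<in>S. \<exists>N g h. open N \<and> connected N \<and> p \<in> N \<and> N \<subseteq> S \<and>
        holomorphic2 g N \<and> holomorphic2 h N \<and> (\<exists>q\<in>N. h q \<noteq> 0) \<and>
        (\<forall>q\<in>N. h q \<noteq> 0 \<longrightarrow> f q = g q / h q))"

definition P01 :: "complex set" where "P01 = - {0, 1}"
definition base_pt :: complex where "base_pt = 1 / 2"

text \<open>Points of the universal cover of P01 are represented by paths in P01 from
  the base point, modulo homotopy rel endpoints.\<close>
definition cover_paths :: "(real \<Rightarrow> complex) set" where
  "cover_paths = {\<gamma>. path \<gamma> \<and> path_image \<gamma> \<subseteq> P01 \<and> pathstart \<gamma> = base_pt}"

text \<open>Local chart of the universal cover around the point represented by gamma.\<close>
definition sheet :: "(real \<Rightarrow> complex) \<Rightarrow> complex \<Rightarrow> (real \<Rightarrow> complex)" where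
  "sheet \<gamma> w = \<gamma> +++ linepath (pathfinish \<gamma>) w"

end

theory Submission
  imports Defs
begin

text \<open>
  In the variable \<open>s = log z\<close>, the function \<open>g\<^sub>j(s) = \<Sum>k. exp((k + c) s) / (k + c)\<^sup>j\<close> satisfies
  \<open>g\<^sub>j' = g\<^sub>j\<^sub>-\<^sub>1\<close> and \<open>g\<^sub>0(s) = exp(c s) / (1 - exp s)\<close>, which is single-valued on the plane minus
  \<open>2 \<pi> i \<int>\<close> and entire in \<open>c\<close>. Taylor's formula with integral remainder at \<open>s\<^sub>0 = log (1/2)\<close> reads
  \<open>g\<^sub>m(S) = (\<Sum>j<m. (S - s\<^sub>0)\<^sup>j / j! \<cdot> g\<^sub>m\<^sub>-\<^sub>j(s\<^sub>0)) + \<integral> (S - s)\<^sup>m\<^sup>-\<^sup>1 / (m - 1)! \<cdot> g\<^sub>0(s) ds\<close>.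
  The right-hand side makes sense along the lift through \<open>exp\<close> of any path avoiding 0 and 1, depends
  only on its homotopy class, and its remainder is entire in \<open>c\<close>. All poles in \<open>c\<close> therefore come
  from the values \<open>g\<^sub>j(s\<^sub>0)\<close>, \<open>j \<le> m\<close>, at the base point; only \<open>g\<^sub>m(s\<^sub>0)\<close> contributes a pole of order
  \<open>m\<close>, so nothing can cancel it on any sheet.
\<close>

section \<open>Lifting paths through the exponential map\<close>

text \<open>Evenly covered neighbourhoods survive: intersect the neighbourhood with \<open>T\<close>
  and each of its sheets with the preimage of \<open>T\<close>. This cuts the exponential covering
  of the punctured plane down to \<open>P01\<close>.\<close>

lemma covering_space_restrict:
  assumes cov: "covering_space C p S" and "T \<subseteq> S"
  shows "covering_space (C \<inter> p -` T) p T"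
proof
  have cont: "continuous_on C p" and surj: "p ` C = S"
    using cov by (auto simp: covering_space_def)
  show "continuous_on (C \<inter> p -` T) p"
    using cont by (rule continuous_on_subset) auto
  show "p ` (C \<inter> p -` T) = T"
    using surj \<open>T \<subseteq> S\<close> by auto
  fix x assume "x \<in> T"
  then have "x \<in> S" using \<open>T \<subseteq> S\<close> by auto
  then have "\<exists>U. x \<in> U \<and> openin (top_of_set S) U \<and>
      (\<exists>V. \<Union>V = C \<inter> p -` U \<and> (\<forall>u\<in>V. openin (top_of_set C) u) \<and> pairwise disjnt V \<and>
        (\<forall>u\<in>V. \<exists>q. homeomorphism u U p q))"
    using cov by (simp add: covering_space_def)
  then obtain U V where U: "x \<in> U" "openin (top_of_set S) U"
    and V: "\<Union>V = C \<inter> p -` U" "\<forall>u\<in>V. openin (top_of_set C) u" "pairwise disjnt V"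
      "\<forall>u\<in>V. \<exists>q. homeomorphism u U p q"
    by (elim exE conjE) rule
  define W where "W = (\<lambda>u. u \<inter> p -` T) ` V"
  show "\<exists>U'. x \<in> U' \<and> openin (top_of_set T) U' \<and>
          (\<exists>v. \<Union>v = (C \<inter> p -` T) \<inter> p -` U' \<and>
            (\<forall>u\<in>v. openin (top_of_set (C \<inter> p -` T)) u) \<and> pairwise disjnt v \<and>
            (\<forall>u\<in>v. \<exists>q. homeomorphism u U' p q))"
  proof (rule exI[of _ "T \<inter> U"], intro conjI exI[of _ W] ballI)
    show "x \<in> T \<inter> U" using \<open>x \<in> T\<close> U by simp
    show "openin (top_of_set T) (T \<inter> U)"
      using U(2) \<open>T \<subseteq> S\<close> by (auto simp: openin_open)
    show "\<Union>W = (C \<inter> p -` T) \<inter> p -` (T \<inter> U)"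
      using V(1) by (auto simp: W_def)
    show "pairwise disjnt W"
      using V(3) unfolding W_def pairwise_def disjnt_def by blast
    fix w assume "w \<in> W"
    then obtain u where u: "u \<in> V" "w = u \<inter> p -` T"
      by (auto simp: W_def)
    obtain O' where "open O'" "u = C \<inter> O'"
      using V(2) u(1) by (auto simp: openin_open)
    then show "openin (top_of_set (C \<inter> p -` T)) w"
      using u(2) by (auto simp: openin_open)
    obtain q where q: "homeomorphism u U p q"
      using V(4) u by blast
    have "homeomorphism w (T \<inter> U) p q"
    proof (rule homeomorphism_of_subsets[OF q])
      show "w \<subseteq> u" using u by auto
      show "p ` w = T \<inter> U"
      proof -
        have "p ` u = U" using q by (simp add: homeomorphism_def)
        then show ?thesis unfolding u(2) by auto
      qed
    qed auto
    then show "\<exists>q. homeomorphism w (T \<inter> U) p q" by blast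
  qed
qed

text \<open>Since \<open>exp\<close> never vanishes, this is the full preimage of
  \<open>P01\<close>; the removed points are exactly the poles of
  \<open>1 / (1 - exp s)\<close>.\<close>

definition expdom :: "complex set" where
  "expdom = {s. exp s \<noteq> 1}"

lemma open_expdom: "open expdom"
proof -
  have "expdom = exp -` (- {1})" by (auto simp: expdom_def)
  moreover have "open (exp -` (- {1::complex}))"
    by (intro open_vimage) (auto intro!: continuous_intros)
  ultimately show ?thesis by simp
qed

lemma covering_space_expdom: "covering_space expdom exp P01"
proof -
  have "expdom = UNIV \<inter> exp -` P01" by (auto simp: expdom_def P01_def)
  then show ?thesis
    using covering_space_restrict[OF covering_space_exp_punctured_plane, of P01]
    by (auto simp: P01_def)
qed

section \<open>Integrals along continuous paths\<close>

text \<open>Paths are only continuous here, so integrals go through a polynomial path in the homotopy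
  class; polynomial paths have the continuous derivative needed to differentiate under the
  integral sign.\<close>
definition cont_integral ::
    "complex set \<Rightarrow> (real \<Rightarrow> complex) \<Rightarrow> (complex \<Rightarrow> complex) \<Rightarrow> complex" where
  "cont_integral S \<sigma> f =
     contour_integral (SOME g. polynomial_function g \<and> homotopic_paths S \<sigma> g) f"

text \<open>In an open set every sufficiently close path with the same ends is homotopic to
  \<open>\<sigma>\<close>, and some polynomial path is that close.\<close>

lemma homotopic_polynomial_path:
  assumes "open S" "path \<sigma>" "path_image \<sigma> \<subseteq> S"
  obtains g :: "real \<Rightarrow> complex" where "polynomial_function g" "homotopic_paths S \<sigma> g"
proof -
  obtain e where e: "e > 0" "\<And>h. path h \<and> pathstart h = pathstart \<sigma> \<and> pathfinish h = pathfinish \<sigma> \<and>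
      (\<forall>t\<in>{0..1}. norm (h t - \<sigma> t) < e) \<Longrightarrow> homotopic_paths S \<sigma> h"
    using homotopic_nearby_paths[OF assms(2,1,3)] by metis
  obtain g where "polynomial_function g" "pathstart g = pathstart \<sigma>" "pathfinish g = pathfinish \<sigma>"
      "\<And>t. t \<in> {0..1} \<Longrightarrow> norm (g t - \<sigma> t) < e"
    using path_approx_polynomial_function[OF assms(2) e(1)] by blast
  then show ?thesis
    using that e(2) path_polynomial_function by blast
qed

text \<open>By Cauchy's theorem for homotopic paths the chosen representative is irrelevant, so any
  convenient valid path in the class computes the integral.\<close>

lemma cont_integral_eq:
  assumes "open S" "f holomorphic_on S" "valid_path h" "homotopic_paths S \<sigma> h"
  shows "cont_integral S \<sigma> f = contour_integral h f"
proof -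
  have "path \<sigma>" "path_image \<sigma> \<subseteq> S"
    using assms(4) homotopic_paths_imp_path homotopic_paths_imp_subset by blast+
  then obtain g0 where "polynomial_function g0 \<and> homotopic_paths S \<sigma> g0"
    using homotopic_polynomial_path[OF assms(1)] by blast
  then have "polynomial_function (SOME g. polynomial_function g \<and> homotopic_paths S \<sigma> g) \<and>
      homotopic_paths S \<sigma> (SOME g. polynomial_function g \<and> homotopic_paths S \<sigma> g)"
    by (rule someI[where P = "\<lambda>g. polynomial_function g \<and> homotopic_paths S \<sigma> g"])
  then show ?thesis
    unfolding cont_integral_def using assms
    by (intro Cauchy_theorem_homotopic_paths[of S])
       (auto intro: valid_path_polynomial_function homotopic_paths_trans homotopic_paths_sym)
qed

lemma cont_integral_homotopic:
  assumes "open S" "f holomorphic_on S" "homotopic_paths S \<sigma> \<tau>"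
  shows "cont_integral S \<sigma> f = cont_integral S \<tau> f"
proof -
  have "path \<tau>" "path_image \<tau> \<subseteq> S"
    using assms(3) homotopic_paths_imp_path homotopic_paths_imp_subset by blast+
  then obtain g where g: "polynomial_function g" "homotopic_paths S \<tau> g"
    using homotopic_polynomial_path[OF assms(1)] by blast
  then have "valid_path g" by (simp add: valid_path_polynomial_function)
  then show ?thesis
    using cont_integral_eq[OF assms(1,2), of g] g(2) homotopic_paths_trans[OF assms(3) g(2)] by simp
qed

text \<open>On a polynomial representative \<open>g\<close>, fixed independently of
  \<open>c\<close>, this is an integral over the unit interval whose integrand has a jointly
  continuous \<open>c\<close>-derivative, so the Leibniz rule applies at every
  \<open>c\<close>.\<close>

lemma cont_integral_exp_kernel_holomorphic:
  assumes "open S" "q holomorphic_on S" "path \<sigma>" "path_image \<sigma> \<subseteq> S"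
  shows "(\<lambda>c. cont_integral S \<sigma> (\<lambda>s. q s * exp (c * s))) holomorphic_on UNIV"
proof -
  obtain g where g: "polynomial_function g" "homotopic_paths S \<sigma> g"
    using homotopic_polynomial_path[OF assms(1,3,4)] .
  have "path_image g \<subseteq> S" using g homotopic_paths_imp_subset by blast
  then have gS: "g t \<in> S" if "t \<in> {0..1}" for t
    using that by (auto simp: path_image_def)
  obtain g' where g': "polynomial_function g'" "\<And>t. (g has_vector_derivative g' t) (at t)"
    using has_vector_derivative_polynomial_function[OF g(1)] by blast
  have [continuous_intros]: "continuous_on A g" "continuous_on A g'" for A
    using g(1) g'(1) by (auto intro: continuous_on_polymonial_function)
  have contq: "continuous_on {0..1} (\<lambda>t. q (g t))"
    by (rule continuous_on_compose2[OF holomorphic_on_imp_continuous_on[OF assms(2)]])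
       (use gS in \<open>auto intro!: continuous_intros\<close>)
  have eq: "cont_integral S \<sigma> (\<lambda>s. q s * exp (c * s)) =
      integral (cbox 0 1) (\<lambda>t. q (g t) * exp (c * g t) * g' t)" for c
  proof -
    have "cont_integral S \<sigma> (\<lambda>s. q s * exp (c * s)) = contour_integral g (\<lambda>s. q s * exp (c * s))"
      using assms g by (intro cont_integral_eq)
        (auto intro!: holomorphic_intros valid_path_polynomial_function)
    also have "\<dots> = integral (cbox 0 1) (\<lambda>t. q (g t) * exp (c * g t) * g' t)"
      using vector_derivative_at[OF g'(2)] by (simp add: contour_integral_integral)
    finally show ?thesis .
  qed
  have "((\<lambda>c. integral (cbox 0 1) (\<lambda>t. q (g t) * exp (c * g t) * g' t)) has_field_derivative
      integral (cbox 0 1) (\<lambda>t. q (g t) * (g t * exp (c * g t)) * g' t)) (at c within UNIV)" for c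
  proof (rule leibniz_rule_field_derivative)
    show "((\<lambda>c. q (g t) * exp (c * g t) * g' t) has_field_derivative
        q (g t) * (g t * exp (c * g t)) * g' t) (at c within UNIV)" for c t
      by (auto intro!: derivative_eq_intros)
    show "(\<lambda>t. q (g t) * exp (c * g t) * g' t) integrable_on cbox 0 1" for c
      by (intro integrable_continuous) (auto intro!: continuous_intros contq)
    have "continuous_on (UNIV \<times> {0..1}) (\<lambda>x::complex \<times> real. q (g (snd x)))"
      by (rule continuous_on_compose2[OF contq]) (auto intro!: continuous_intros)
    moreover have "continuous_on (UNIV \<times> {0..1}) (\<lambda>x::complex \<times> real. g (snd x))"
       "continuous_on (UNIV \<times> {0..1}) (\<lambda>x::complex \<times> real. g' (snd x))"
      by (rule continuous_on_compose2[where g=g and t=UNIV], auto intro!: continuous_intros)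
         (rule continuous_on_compose2[where g=g' and t=UNIV], auto intro!: continuous_intros)
    ultimately show "continuous_on (UNIV \<times> cbox 0 1)
        (\<lambda>(c, t). q (g t) * (g t * exp (c * g t)) * g' t)"
      by (auto simp: case_prod_beta intro!: continuous_intros)
  qed auto
  then show ?thesis
    unfolding eq by (auto simp: holomorphic_on_def field_differentiable_def)
qed

text \<open>On the convex set \<open>D\<close> the integrand has a primitive \<open>P\<close>;
  moving the end point within \<open>D\<close> changes the integral only by the increment of
  \<open>P\<close> along the last segment.\<close>

lemma cont_integral_join_linepath_has_derivative:
  assumes "open S" "f holomorphic_on S" "path \<sigma>" "path_image \<sigma> \<subseteq> S"
    and D: "open D" "convex D" "D \<subseteq> S" "pathfinish \<sigma> \<in> D" and s: "s \<in> D"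
  shows "((\<lambda>s. cont_integral S (\<sigma> +++ linepath (pathfinish \<sigma>) s) f) has_field_derivative f s) (at s)"
proof -
  obtain g where g: "polynomial_function g" "homotopic_paths S \<sigma> g"
    using homotopic_polynomial_path[OF assms(1,3,4)] .
  have fing: "pathfinish g = pathfinish \<sigma>"
    using g(2) homotopic_paths_imp_pathfinish by metis
  have vg: "valid_path g" and gS: "path_image g \<subseteq> S"
    using g homotopic_paths_imp_subset valid_path_polynomial_function by blast+
  obtain P where P: "\<And>x. x \<in> D \<Longrightarrow> (P has_field_derivative f x) (at x within D)"
    using holomorphic_convex_primitive'[OF D(2,1) holomorphic_on_subset[OF assms(2) D(3)]] by blast
  have eq: "cont_integral S (\<sigma> +++ linepath (pathfinish \<sigma>) x) f =
      contour_integral g f + (P x - P (pathfinish \<sigma>))" if x: "x \<in> D" for x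
  proof -
    have seg: "closed_segment (pathfinish \<sigma>) x \<subseteq> D"
      using D x by (simp add: closed_segment_subset)
    have "homotopic_paths S (\<sigma> +++ linepath (pathfinish \<sigma>) x) (g +++ linepath (pathfinish \<sigma>) x)"
      using g(2) seg D(3) by (intro homotopic_paths_join) auto
    then have "cont_integral S (\<sigma> +++ linepath (pathfinish \<sigma>) x) f =
        contour_integral (g +++ linepath (pathfinish \<sigma>) x) f"
      using assms vg fing by (intro cont_integral_eq) (auto intro: valid_path_join)
    also have "\<dots> = contour_integral g f + contour_integral (linepath (pathfinish \<sigma>) x) f"
      using assms vg fing gS seg
      by (intro contour_integral_join contour_integrable_holomorphic_simple[of f S]) auto
    also have "contour_integral (linepath (pathfinish \<sigma>) x) f = P x - P (pathfinish \<sigma>)"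
      using contour_integral_primitive[OF P, of "linepath (pathfinish \<sigma>) x"] seg
      by (auto intro: contour_integral_unique)
    finally show ?thesis .
  qed
  have "((\<lambda>x. contour_integral g f + (P x - P (pathfinish \<sigma>))) has_field_derivative f s) (at s)"
  proof -
    have "(P has_field_derivative f s) (at s)"
      using P[OF s] at_within_open[OF s D(1)] by simp
    then show ?thesis by (auto intro!: derivative_eq_intros)
  qed
  then show ?thesis
    by (rule has_field_derivative_transform_within_open[OF _ D(1) s]) (simp add: eq)
qed

section \<open>Holomorphic functions of two variables\<close>

lemma holomorphic2I:
  assumes "\<And>w c. (w, c) \<in> S \<Longrightarrow> \<exists>a b. (f has_derivative (\<lambda>(u, v). a * u + b * v)) (at (w, c))"
  shows "holomorphic2 f S"
  using assms by (auto simp: holomorphic2_def)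

lemma holomorphic2_subset: "holomorphic2 f S \<Longrightarrow> T \<subseteq> S \<Longrightarrow> holomorphic2 f T"
  by (auto simp: holomorphic2_def)

lemma holomorphic2_transform:
  assumes "holomorphic2 f S" "open S" "\<And>q. q \<in> S \<Longrightarrow> f q = g q"
  shows "holomorphic2 g S"
  using assms unfolding holomorphic2_def
  by (meson has_derivative_transform_within_open)

lemma holomorphic2_const: "holomorphic2 (\<lambda>_. k) S"
proof (rule holomorphic2I, intro exI)
  show "((\<lambda>_. k) has_derivative (\<lambda>(u, v). 0 * u + 0 * v)) (at (w, c))" for w c
    using has_derivative_const[of k "at (w, c)"] by (simp add: case_prod_unfold)
qed

lemma holomorphic2_add:
  assumes "holomorphic2 f S" "holomorphic2 g S"
  shows "holomorphic2 (\<lambda>q. f q + g q) S"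
proof (rule holomorphic2I)
  fix w c assume "(w, c) \<in> S"
  then obtain a b a' b' where "(f has_derivative (\<lambda>(u, v). a * u + b * v)) (at (w, c))"
      "(g has_derivative (\<lambda>(u, v). a' * u + b' * v)) (at (w, c))"
    using assms unfolding holomorphic2_def by meson
  from has_derivative_add[OF this]
  have "((\<lambda>q. f q + g q) has_derivative (\<lambda>(u, v). (a + a') * u + (b + b') * v)) (at (w, c))"
    by (rule has_derivative_eq_rhs) (auto simp: fun_eq_iff algebra_simps)
  then show "\<exists>a b. ((\<lambda>q. f q + g q) has_derivative (\<lambda>(u, v). a * u + b * v)) (at (w, c))"
    by blast
qed

lemma holomorphic2_mult:
  assumes "holomorphic2 f S" "holomorphic2 g S"
  shows "holomorphic2 (\<lambda>q. f q * g q) S"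
proof (rule holomorphic2I)
  fix w c assume "(w, c) \<in> S"
  then obtain a b a' b' where "(f has_derivative (\<lambda>(u, v). a * u + b * v)) (at (w, c))"
      "(g has_derivative (\<lambda>(u, v). a' * u + b' * v)) (at (w, c))"
    using assms unfolding holomorphic2_def by meson
  from has_derivative_mult[OF this]
  have "((\<lambda>q. f q * g q) has_derivative (\<lambda>(u, v). (f (w, c) * a' + a * g (w, c)) * u +
      (f (w, c) * b' + b * g (w, c)) * v)) (at (w, c))"
    by (rule has_derivative_eq_rhs) (auto simp: fun_eq_iff algebra_simps)
  then show "\<exists>a b. ((\<lambda>q. f q * g q) has_derivative (\<lambda>(u, v). a * u + b * v)) (at (w, c))"
    by blast
qed

lemma holomorphic2_sum:
  assumes "\<And>i. i \<in> I \<Longrightarrow> holomorphic2 (f i) S"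
  shows "holomorphic2 (\<lambda>q. \<Sum>i\<in>I. f i q) S"
  using assms
  by (induction I rule: infinite_finite_induct)
     (auto intro: holomorphic2_const holomorphic2_add)

lemma holomorphic2_compose:
  assumes f: "holomorphic2 f S" and g: "\<And>q. q \<in> S \<Longrightarrow> g field_differentiable at (f q)"
  shows "holomorphic2 (\<lambda>q. g (f q)) S"
proof (rule holomorphic2I)
  fix w c assume wc: "(w, c) \<in> S"
  then obtain a b where ab: "(f has_derivative (\<lambda>(u, v). a * u + b * v)) (at (w, c))"
    using f unfolding holomorphic2_def by meson
  obtain d where "(g has_derivative (*) d) (at (f (w, c)))"
    using g[OF wc] by (auto simp: field_differentiable_def has_field_derivative_def)
  from has_derivative_compose[OF ab this]
  have "((\<lambda>q. g (f q)) has_derivative (\<lambda>(u, v). (d * a) * u + (d * b) * v)) (at (w, c))"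
    by (rule has_derivative_eq_rhs) (auto simp: fun_eq_iff algebra_simps)
  then show "\<exists>a b. ((\<lambda>q. g (f q)) has_derivative (\<lambda>(u, v). a * u + b * v)) (at (w, c))"
    by blast
qed

lemma holomorphic2_fst: "holomorphic2 fst S"
proof (rule holomorphic2I, intro exI)
  show "(fst has_derivative (\<lambda>(u, v). 1 * u + 0 * v)) (at (w, c))" for w c :: complex
    by (rule has_derivative_eq_rhs[OF has_derivative_fst[OF has_derivative_ident]])
       (auto simp: fun_eq_iff)
qed

lemma holomorphic2_snd: "holomorphic2 snd S"
proof (rule holomorphic2I, intro exI)
  show "(snd has_derivative (\<lambda>(u, v). 0 * u + 1 * v)) (at (w, c))" for w c :: complex
    by (rule has_derivative_eq_rhs[OF has_derivative_snd[OF has_derivative_ident]])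
       (auto simp: fun_eq_iff)
qed

lemma holomorphic2_compose_fst:
  assumes "holomorphic2 f (D \<times> C)" "l holomorphic_on B" "open B" "l ` B \<subseteq> D"
  shows "holomorphic2 (\<lambda>(w, c). f (l w, c)) (B \<times> C)"
proof (rule holomorphic2I)
  fix w c assume wc: "(w, c) \<in> B \<times> C"
  then obtain a b where ab: "(f has_derivative (\<lambda>(u, v). a * u + b * v)) (at (l w, c))"
    using assms(1,4) unfolding holomorphic2_def by blast
  obtain d where d: "(l has_derivative (*) d) (at w)"
    using assms(2,3) wc holomorphic_on_imp_differentiable_at[of l B w]
    by (auto simp: field_differentiable_def has_field_derivative_def)
  have "((\<lambda>q. (l (fst q), snd q)) has_derivative (\<lambda>q. (d * fst q, snd q))) (at (w, c))"
    by (intro has_derivative_Pair has_derivative_compose[OF has_derivative_fst[OF has_derivative_ident]]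
        has_derivative_snd has_derivative_ident) (use d in simp)
  from has_derivative_compose[OF this, of f "\<lambda>(u, v). a * u + b * v"] ab
  have "((\<lambda>q. f (l (fst q), snd q)) has_derivative (\<lambda>(u, v). (a * d) * u + b * v)) (at (w, c))"
    by (simp add: case_prod_unfold mult.assoc)
  then show "\<exists>a b. ((\<lambda>(w, c). f (l w, c)) has_derivative (\<lambda>(u, v). a * u + b * v)) (at (w, c))"
    by (auto simp: case_prod_unfold)
qed

lemma holomorphic2_imp_holomorphic_snd:
  assumes "holomorphic2 f ({w} \<times> C)"
  shows "(\<lambda>c. f (w, c)) holomorphic_on C"
  unfolding holomorphic_on_def
proof
  fix c assume "c \<in> C"
  then obtain a b where ab: "(f has_derivative (\<lambda>(u, v). a * u + b * v)) (at (w, c))"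
    using assms unfolding holomorphic2_def by blast
  have "((\<lambda>c. (w, c)) has_derivative (\<lambda>v. (0, v))) (at c)"
    by (auto intro!: derivative_eq_intros)
  from has_derivative_compose[OF this ab]
  have "((\<lambda>c. f (w, c)) has_derivative (\<lambda>v. b * v)) (at c)"
    by simp
  then show "(\<lambda>c. f (w, c)) field_differentiable at c within C"
    by (auto simp: field_differentiable_def has_field_derivative_def intro: has_derivative_at_withinI)
qed

text \<open>Existence of both partials and joint continuity of one give total differentiability. The
  continuous one is the \<open>s\<close>-partial, which for the integrals below is simply the
  integrand.\<close>

lemma holomorphic2_of_partials:
  assumes "open D" "convex D" and hol: "\<And>s. s \<in> D \<Longrightarrow> K s holomorphic_on UNIV"
    and k: "\<And>s c. s \<in> D \<Longrightarrow> ((\<lambda>s. K s c) has_field_derivative k s c) (at s)"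
    and cont: "continuous_on (D \<times> UNIV) (\<lambda>(s, c). k s c)"
  shows "holomorphic2 (\<lambda>(s, c). K s c) (D \<times> UNIV)"
proof (rule holomorphic2I)
  fix s c assume "(s, c) \<in> D \<times> (UNIV :: complex set)"
  then have s: "s \<in> D" by simp
  obtain b where b: "((\<lambda>c. K s c) has_field_derivative b) (at c)"
    using hol[OF s] by (auto simp: holomorphic_on_def field_differentiable_def)
  \<comment> \<open>The rule for partial derivatives wants the continuous partial in the second
    slot, hence the swapped pair \<open>(c, s)\<close>; the swap is undone afterwards by
    composition.\<close>
  have "((\<lambda>(c, s). K s c) has_derivative (\<lambda>(tx, ty). b * tx + blinfun_mult_right (k s c) ty))
      (at (c, s) within UNIV \<times> D)"
  proof (rule has_derivative_partialsI)
    show "((\<lambda>c. K s c) has_derivative (*) b) (at c within UNIV)"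
      using b by (simp add: has_field_derivative_def)
    show "((\<lambda>s. K s c) has_derivative blinfun_apply (blinfun_mult_right (k s c))) (at s within D)"
      if "s \<in> D" for s c
      using k[OF that, of c] by (auto simp: has_field_derivative_def intro: has_derivative_at_withinI)
    have "continuous_on (UNIV \<times> D) (\<lambda>x. (\<lambda>(s, c). k s c) (snd x, fst x))"
      by (rule continuous_on_compose2[OF cont]) (auto intro!: continuous_intros)
    then have "continuous_on (UNIV \<times> D) (\<lambda>(c, s). blinfun_mult_right (k s c))"
      by (auto simp: case_prod_unfold intro!: continuous_intros)
    then show "continuous (at (c, s) within UNIV \<times> D) (\<lambda>(c, s). blinfun_mult_right (k s c))"
      using s by (auto simp: continuous_on_eq_continuous_within)
  qed (use s assms in auto)
  then have *: "((\<lambda>(c, s). K s c) has_derivative (\<lambda>(v, u). b * v + k s c * u)) (at (c, s))"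
    using s assms(1) at_within_open[of "(c, s)" "UNIV \<times> D"] by (simp add: open_Times)
  have "((\<lambda>x. (snd x, fst x)) has_derivative (\<lambda>x. (snd x, fst x))) (at (s, c))"
    by (auto intro!: derivative_eq_intros)
  from has_derivative_compose[OF this, of "\<lambda>(c, s). K s c" "\<lambda>(v, u). b * v + k s c * u"] *
  have "((\<lambda>(s, c). K s c) has_derivative (\<lambda>(u, v). k s c * u + b * v)) (at (s, c))"
    by (simp add: case_prod_unfold add.commute)
  then show "\<exists>a b. ((\<lambda>(s, c). K s c) has_derivative (\<lambda>(u, v). a * u + b * v)) (at (s, c))"
    by blast
qed

section \<open>The Lerch series\<close>

text \<open>This is \<open>Li\<close> stripped of one factor \<open>z\<close>; then
  \<open>exp (c * s) * lerch j (exp s) c\<close> is the function \<open>g\<^sub>j(s)\<close> of the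
  opening comment.\<close>

definition lerch :: "nat \<Rightarrow> complex \<Rightarrow> complex \<Rightarrow> complex" where
  "lerch j z c = (\<Sum>k. z ^ k / (of_nat k + c) ^ j)"

text \<open>Denominators eventually have norm at least 1, so the geometric series dominates. The
  poles in \<open>c\<close> are covered too: for \<open>j > 0\<close> the offending term is a
  division by zero, hence 0.\<close>

lemma summable_lerch:
  fixes z c :: complex
  assumes "norm z < 1"
  shows "summable (\<lambda>k. z ^ k / (of_nat k + c) ^ j)"
proof (rule summable_comparison_test')
  show "summable (\<lambda>k. norm z ^ k)" using assms by simp
  fix k assume k: "k \<ge> nat \<lceil>norm c + 1\<rceil>"
  then have "real k \<ge> norm c + 1" by linarith
  moreover have "real k \<le> norm (of_nat k + c) + norm c"
    using norm_triangle_ineq4[of "of_nat k + c" c] by simp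
  ultimately have "1 \<le> norm (of_nat k + c)" by linarith
  then have "1 \<le> norm (of_nat k + c) ^ j" by (rule one_le_power)
  then show "norm (z ^ k / (of_nat k + c) ^ j) \<le> norm z ^ k"
    by (simp add: norm_divide norm_power divide_le_eq mult_left_le[of _ 1] mult_le_cancel_left1)
qed

lemma Li_eq_lerch:
  assumes "norm z < 1"
  shows "Li m z c = z * lerch m z c"
  unfolding Li_def lerch_def using suminf_mult[OF summable_lerch[OF assms], of z c m] by simp

lemma lerch_0:
  assumes "norm z < 1"
  shows "lerch 0 z c = 1 / (1 - z)"
  using suminf_geometric[OF assms] by (simp add: lerch_def)

text \<open>Reindexing the tail replaces \<open>c\<close> by \<open>c + N\<close>: the singular
  terms are confined to a finite sum, while the tail moves into the half-plane where the series is
  holomorphic.\<close>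

lemma lerch_shift:
  assumes "norm z < 1"
  shows "lerch j z c = (\<Sum>k<N. z ^ k / (of_nat k + c) ^ j) + z ^ N * lerch j z (c + of_nat N)"
proof -
  have "lerch j z c = (\<Sum>k. z ^ (k + N) / (of_nat (k + N) + c) ^ j) + (\<Sum>k<N. z ^ k / (of_nat k + c) ^ j)"
    unfolding lerch_def using suminf_split_initial_segment[OF summable_lerch[OF assms]] .
  also have "(\<Sum>k. z ^ (k + N) / (of_nat (k + N) + c) ^ j) =
      (\<Sum>k. z ^ N * (z ^ k / (of_nat k + (c + of_nat N)) ^ j))"
    by (simp add: power_add algebra_simps)
  also have "\<dots> = z ^ N * lerch j z (c + of_nat N)"
    unfolding lerch_def by (rule suminf_mult[OF summable_lerch[OF assms]])
  finally show ?thesis by simp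
qed

lemma lerch_holomorphic_halfplane:
  assumes z: "norm z < 1"
  shows "lerch j z holomorphic_on {c. Re c > 0}"
proof (rule holomorphic_uniform_sequence)
  show "open {c. Re c > 0}" by (rule open_halfspace_Re_gt)
  show "(\<lambda>c. \<Sum>k<n. z ^ k / (of_nat k + c) ^ j) holomorphic_on {c. Re c > 0}" for n
  proof (intro holomorphic_intros)
    fix k c assume "c \<in> {c. Re c > 0}"
    then have "Re (of_nat k + c) > 0" by simp
    then have "of_nat k + c \<noteq> 0" by (metis less_irrefl zero_complex.sel(1))
    then show "(of_nat k + c) ^ j \<noteq> 0" by simp
  qed
  fix x assume x: "x \<in> {c. Re c > 0}"
  \<comment> \<open>Half of \<open>Re x\<close> keeps \<open>Re c \<ge> d\<close> on the closed
    disk, which bounds the denominators below by \<open>d ^ j\<close> for the M-test.\<close>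
  define d where "d = Re x / 2"
  have d: "0 < d" using x by (simp add: d_def)
  have Re_ge: "Re c \<ge> d" if "c \<in> cball x d" for c
    using that abs_Re_le_cmod[of "x - c"] by (simp add: d_def dist_norm)
  have "uniform_limit (cball x d) (\<lambda>n c. \<Sum>k<n. z ^ k / (of_nat k + c) ^ j) (lerch j z) sequentially"
    unfolding lerch_def
  proof (rule Weierstrass_m_test)
    show "norm (z ^ k / (of_nat k + c) ^ j) \<le> norm z ^ k / d ^ j" if "c \<in> cball x d" for k c
    proof -
      have "d \<le> norm (of_nat k + c)"
        using Re_ge[OF that] complex_Re_le_cmod[of "of_nat k + c"] by simp
      moreover from this have "0 < norm (of_nat k + c) ^ j" using d by (intro zero_less_power) linarith
      ultimately show ?thesis
        using d by (auto simp: norm_divide norm_power intro!: divide_left_mono power_mono mult_pos_pos)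
    qed
    show "summable (\<lambda>k. norm z ^ k / d ^ j)"
      using z by (intro summable_divide) simp
  qed
  moreover have "cball x d \<subseteq> {c. Re c > 0}"
    using Re_ge d by force
  ultimately show "\<exists>d>0. cball x d \<subseteq> {c. Re c > 0} \<and>
      uniform_limit (cball x d) (\<lambda>n c. \<Sum>k<n. z ^ k / (of_nat k + c) ^ j) (lerch j z) sequentially"
    using d by blast
qed

lemma lerch_shift_holomorphic:
  assumes z: "norm z < 1"
  shows "(\<lambda>c. z ^ N * lerch j z (c + of_nat N)) holomorphic_on {c. Re c > - real N}"
proof -
  have "(lerch j z \<circ> (\<lambda>c. c + of_nat N)) holomorphic_on {c. Re c > - real N}"
    by (rule holomorphic_on_compose_gen[OF _ lerch_holomorphic_halfplane[OF z]])
       (auto intro!: holomorphic_intros)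
  then show ?thesis
    by (auto intro!: holomorphic_intros simp: o_def)
qed

lemma lerch_holomorphic:
  assumes z: "norm z < 1"
  shows "lerch j z holomorphic_on (- \<int>\<^sub>\<le>\<^sub>0)"
  unfolding holomorphic_on_def
proof
  fix c :: complex assume c: "c \<in> - \<int>\<^sub>\<le>\<^sub>0"
  \<comment> \<open>After \<open>N\<close> terms the tail is holomorphic around \<open>c\<close>;
    the finite sum has poles only at nonpositive integers.\<close>
  obtain N where N: "- Re c < real N" using reals_Archimedean2 by blast
  define U where "U = - \<int>\<^sub>\<le>\<^sub>0 \<inter> {c. Re c > - real N}"
  have "(\<lambda>c. \<Sum>k<N. z ^ k / (of_nat k + c) ^ j) holomorphic_on U"
    by (intro holomorphic_intros) (auto simp: U_def add.commute dest: plus_of_nat_eq_0_imp)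
  moreover have "(\<lambda>c. z ^ N * lerch j z (c + of_nat N)) holomorphic_on U"
    by (rule holomorphic_on_subset[OF lerch_shift_holomorphic[OF z]]) (auto simp: U_def)
  ultimately have "(\<lambda>c. (\<Sum>k<N. z ^ k / (of_nat k + c) ^ j) + z ^ N * lerch j z (c + of_nat N)) holomorphic_on U"
    by (rule holomorphic_on_add)
  then have "lerch j z holomorphic_on U"
    by (rule holomorphic_transform) (rule lerch_shift[OF z, symmetric])
  moreover have "open U" unfolding U_def
    by (intro open_Int open_halfspace_Re_gt) (simp add: open_Compl)
  moreover have "c \<in> U" using c N by (auto simp: U_def)
  ultimately have "lerch j z field_differentiable at c"
    by (rule holomorphic_on_imp_differentiable_at)
  then show "lerch j z field_differentiable at c within - \<int>\<^sub>\<le>\<^sub>0"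
    by (rule field_differentiable_at_within)
qed

text \<open>The term \<open>k = n\<close> alone is the principal part at \<open>- n\<close>. Earlier
  terms have their poles at distance at least 1, and the later ones form a tail holomorphic for
  \<open>Re c > - (n + 1)\<close>.\<close>

lemma lerch_principal_part:
  assumes z: "norm z < 1"
  obtains R where "R holomorphic_on ball (- of_nat n) 1"
    "\<And>c. lerch j z c = z ^ n / (c + of_nat n) ^ j + R c"
proof
  define R where "R c = (\<Sum>k<n. z ^ k / (of_nat k + c) ^ j) + z ^ Suc n * lerch j z (c + of_nat (Suc n))" for c
  show "lerch j z c = z ^ n / (c + of_nat n) ^ j + R c" for c
    using lerch_shift[OF z, of j c "Suc n"] by (simp add: R_def add.commute)
  have ball: "\<bar>Re c + real n\<bar> < 1" if "c \<in> ball (- of_nat n) 1" for c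
  proof -
    have "norm (c + of_nat n) < 1"
      using that by (simp add: dist_norm norm_minus_commute)
    then show ?thesis using abs_Re_le_cmod[of "c + of_nat n"] by simp
  qed
  have "(\<lambda>c. \<Sum>k<n. z ^ k / (of_nat k + c) ^ j) holomorphic_on ball (- of_nat n) 1"
  proof (intro holomorphic_intros)
    fix k c assume "k \<in> {..<n}" "c \<in> ball (- of_nat n :: complex) 1"
    then have "Re (of_nat k + c) < 0"
      using ball[of c] by auto
    then have "of_nat k + c \<noteq> 0" by (metis less_irrefl zero_complex.sel(1))
    then show "(of_nat k + c) ^ j \<noteq> 0" by simp
  qed
  moreover have "(\<lambda>c. z ^ Suc n * lerch j z (c + of_nat (Suc n))) holomorphic_on ball (- of_nat n) 1"
    by (rule holomorphic_on_subset[OF lerch_shift_holomorphic[OF z]]) (use ball in force)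
  ultimately show "R holomorphic_on ball (- of_nat n) 1"
    unfolding R_def[abs_def] by (rule holomorphic_on_add)
qed

text \<open>With \<open>z = exp s\<close>, the function \<open>exp (c * s) * z ^ k\<close> of
  \<open>s\<close> is an eigenfunction of differentiation with eigenvalue \<open>k + c\<close>, so
  termwise differentiation cancels one power of the denominator.\<close>

lemma lerch_has_derivative:
  assumes s: "Re s < 0" and c: "Re c > 0"
  shows "((\<lambda>s. exp (c * s) * lerch (Suc j) (exp s) c) has_field_derivative
    exp (c * s) * lerch j (exp s) c) (at s)"
proof -
  define a where "a k = 1 / (of_nat k + c) ^ Suc j" for k
  define z where "z = exp s"
  have z: "norm z < 1" using s by (simp add: z_def)
  \<comment> \<open>Termwise differentiation at \<open>z\<close> requires convergence at a point of
    strictly larger modulus.\<close>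
  obtain r where r: "norm z < r" "r < 1" using dense[OF z] by blast
  have K: "norm z < norm (of_real r :: complex)" using r order_le_less_trans[OF norm_ge_zero r(1)] by simp
  have sumK: "summable (\<lambda>k. a k * of_real r ^ k)"
    using summable_lerch[of "of_real r" c "Suc j"] r order_le_less_trans[OF norm_ge_zero r(1)]
    by (simp add: a_def)
  have L: "lerch (Suc j) w c = (\<Sum>k. a k * w ^ k)" for w
    by (simp add: lerch_def a_def)
  define P' where "P' = (\<Sum>k. diffs a k * z ^ k)"
  have P': "((\<lambda>w. lerch (Suc j) w c) has_field_derivative P') (at z)"
    unfolding L P'_def by (rule termdiffs_strong[OF sumK K])
  have "summable (\<lambda>k. diffs a k * z ^ k)"
    using z summable_lerch[of _ c "Suc j"] by (intro termdiff_converges[of z 1]) (auto simp: a_def)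
  then have "(\<lambda>k. of_nat k * a k * z ^ (k - Suc 0)) sums P'"
    unfolding P'_def by (rule diffs_equiv)
  then have "(\<lambda>k. z * (of_nat k * a k * z ^ (k - Suc 0))) sums (z * P')"
    by (rule sums_mult)
  \<comment> \<open>For \<open>k = 0\<close> the truncated exponent would be off, but there the
    coefficient \<open>of_nat k\<close> vanishes.\<close>
  moreover have "z * (of_nat k * a k * z ^ (k - Suc 0)) = of_nat k * a k * z ^ k" for k
    by (cases k) auto
  ultimately have 1: "(\<lambda>k. of_nat k * a k * z ^ k) sums (z * P')"
    by simp
  have "(\<lambda>k. a k * z ^ k) sums lerch (Suc j) z c"
    unfolding L using summable_lerch[OF z, of c "Suc j"] by (intro summable_sums) (simp add: a_def)
  then have "(\<lambda>k. c * (a k * z ^ k)) sums (c * lerch (Suc j) z c)"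
    by (rule sums_mult)
  from sums_add[OF this 1]
  have "(\<lambda>k. c * (a k * z ^ k) + of_nat k * a k * z ^ k) sums (c * lerch (Suc j) z c + z * P')" .
  moreover have "c * (a k * z ^ k) + of_nat k * a k * z ^ k = z ^ k / (of_nat k + c) ^ j" for k
  proof -
    have "of_nat k + c \<noteq> 0" using c by (auto simp: complex_eq_iff)
    moreover have "c * (a k * z ^ k) + of_nat k * a k * z ^ k = (of_nat k + c) * a k * z ^ k"
      by (simp add: algebra_simps)
    ultimately show ?thesis by (simp add: a_def)
  qed
  ultimately have "lerch j z c = c * lerch (Suc j) z c + z * P'"
    unfolding lerch_def by (simp add: sums_iff)
  moreover have "((\<lambda>s. exp (c * s) * lerch (Suc j) (exp s) c) has_field_derivative
      exp (c * s) * c * lerch (Suc j) z c + exp (c * s) * (P' * z)) (at s)"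
    using DERIV_chain2[OF P'[unfolded z_def] DERIV_exp]
    by (auto intro!: derivative_eq_intros simp: z_def)
  ultimately show ?thesis
    by (simp add: z_def algebra_simps)
qed

section \<open>Continuation along lifted paths\<close>

text \<open>The common start of all lifted paths: the real number \<open>- ln 2\<close>, in the left
  half-plane that lies over the punctured unit disk.\<close>

definition log_base :: complex where
  "log_base = Ln base_pt"

lemma exp_log_base: "exp log_base = base_pt"
  by (simp add: log_base_def base_pt_def)

lemma base_pt_norm: "norm base_pt < 1"
  by (simp add: base_pt_def norm_divide)

lemma halfplane_subset_expdom: "{s. Re s < 0} \<subseteq> expdom"
proof
  fix s assume "s \<in> {s. Re s < 0}"
  then have "norm (exp s) < 1" by simp
  then have "exp s \<noteq> 1" by (metis less_irrefl norm_one)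
  then show "s \<in> expdom" by (simp add: expdom_def)
qed

text \<open>Taylor's formula along \<open>\<sigma>\<close> for \<open>m = p + 1\<close>; the kernel \<open>(S - s) ^ p / p!\<close> of the remainder
  is expanded in powers of the end point \<open>S\<close>, so that no integrand depends on \<open>S\<close>.\<close>
definition lifted :: "nat \<Rightarrow> (real \<Rightarrow> complex) \<Rightarrow> complex \<Rightarrow> complex" where
  "lifted p \<sigma> c = exp ((1 - c) * pathfinish \<sigma>) *
     (exp (c * log_base) *
        (\<Sum>j\<le>p. (pathfinish \<sigma> - log_base) ^ j / fact j * lerch (Suc p - j) base_pt c) +
      (\<Sum>i\<le>p. of_nat (p choose i) / fact p * pathfinish \<sigma> ^ i *
        cont_integral expdom \<sigma> (\<lambda>s. (- s) ^ (p - i) / (1 - exp s) * exp (c * s))))"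

lemma kernel_holomorphic: "(\<lambda>s. (- s) ^ k / (1 - exp s)) holomorphic_on expdom"
  by (auto intro!: holomorphic_intros simp: expdom_def)

lemma exp_kernel_holomorphic:
  "(\<lambda>s. (- s) ^ k / (1 - exp s) * exp (c * s)) holomorphic_on expdom"
  by (intro holomorphic_intros kernel_holomorphic)

lemma lifted_homotopic:
  assumes "homotopic_paths expdom \<sigma> \<tau>"
  shows "lifted p \<sigma> = lifted p \<tau>"
proof
  fix c
  have "pathfinish \<sigma> = pathfinish \<tau>"
    using assms homotopic_paths_imp_pathfinish by blast
  then show "lifted p \<sigma> c = lifted p \<tau> c"
    unfolding lifted_def
    by (simp only: cont_integral_homotopic[OF open_expdom exp_kernel_holomorphic assms])
qed

section \<open>Taylor's formula and agreement with the series over the unit disk\<close>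

text \<open>Differentiating a Taylor sum in its centre \<open>s\<close> telescopes down to the
  remainder kernel. The induction hypothesis is used at \<open>Suc q\<close>: its surviving term
  cancels the one from differentiating the newly added power.\<close>

lemma Taylor_sum_has_derivative:
  fixes G :: "nat \<Rightarrow> complex \<Rightarrow> complex"
  assumes "\<And>j. (G (Suc j) has_field_derivative G j s) (at s)"
  shows "((\<lambda>s. \<Sum>j\<le>p. (S - s) ^ j / fact j * G (q + Suc p - j) s) has_field_derivative
    (S - s) ^ p / fact p * G q s) (at s)"
proof (induction p arbitrary: q)
  case 0
  then show ?case using assms[of q] by simp
next
  case (Suc p)
  have "((\<lambda>s. (S - s) ^ Suc p / fact (Suc p) * G (Suc q) s) has_field_derivative
      - ((S - s) ^ p / fact p) * G (Suc q) s + (S - s) ^ Suc p / fact (Suc p) * G q s) (at s)"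
  proof -
    have "((\<lambda>s. (S - s) ^ Suc p / fact (Suc p)) has_field_derivative - ((S - s) ^ p / fact p)) (at s)"
    proof -
      have "((\<lambda>s. (S - s) ^ Suc p) has_field_derivative of_nat (Suc p) * (- ((S - s) ^ p))) (at s)"
        by (auto intro!: derivative_eq_intros simp del: power_Suc)
      from DERIV_cdivide[OF this, of "fact (Suc p)"] show ?thesis
        by (simp only: fact_Suc of_nat_mult of_nat_fact mult_divide_mult_cancel_left of_nat_eq_0_iff
            nat.distinct minus_divide_left not_False_eq_True)
    qed
    from DERIV_mult[OF this assms[of q]] show ?thesis
      by (simp add: algebra_simps)
  qed
  from DERIV_add[OF Suc[of "Suc q"] this] show ?case
    by simp
qed

lemma homotopic_paths_convex:
  fixes p q :: "real \<Rightarrow> 'a::real_normed_vector"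
  assumes "convex S" "path p" "path_image p \<subseteq> S" "path q" "path_image q \<subseteq> S"
    "pathstart q = pathstart p" "pathfinish q = pathfinish p"
  shows "homotopic_paths S p q"
proof (rule homotopic_paths_linear)
  fix t :: real assume "t \<in> {0..1}"
  then show "closed_segment (p t) (q t) \<subseteq> S"
    using assms by (intro closed_segment_subset) (auto simp: path_image_def)
qed (use assms in auto)

text \<open>The half-plane is convex, so \<open>\<sigma>\<close> may be replaced by a segment; there
  the series satisfy the derivative relations literally, and Taylor's formula with exact remainder
  returns the series itself.\<close>

lemma lifted_halfplane:
  assumes \<sigma>: "path \<sigma>" "path_image \<sigma> \<subseteq> {s. Re s < 0}" "pathstart \<sigma> = log_base" and c: "Re c > 0"
  shows "lifted p \<sigma> c = Li (Suc p) (exp (pathfinish \<sigma>)) c"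
proof -
  define S where "S = pathfinish \<sigma>"
  define H where "H = {s::complex. Re s < 0}"
  have H: "convex H" "open H" unfolding H_def by (auto simp: convex_halfspace_Re_lt open_halfspace_Re_lt)
  have S: "S \<in> H" and b: "log_base \<in> H"
    using \<sigma> pathfinish_in_path_image[of \<sigma>] pathstart_in_path_image[of \<sigma>]
    by (auto simp: S_def H_def)
  have seg: "closed_segment log_base S \<subseteq> H" using H S b by (simp add: closed_segment_subset)
  have "homotopic_paths H \<sigma> (linepath log_base S)"
    using \<sigma> seg by (intro homotopic_paths_convex H) (auto simp: S_def H_def)
  then have hom: "homotopic_paths expdom \<sigma> (linepath log_base S)"
    using halfplane_subset_expdom homotopic_paths_subset unfolding H_def by blast
  define f where "f k s = (- s) ^ k / (1 - exp s) * exp (c * s)" for k s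
  define coef where "coef i = of_nat (p choose i) / fact p * S ^ i" for i
  have int: "cont_integral expdom \<sigma> (f k) = contour_integral (linepath log_base S) (f k)" for k
    unfolding f_def by (rule cont_integral_eq[OF open_expdom exp_kernel_holomorphic _ hom]) simp
  have "(f k has_contour_integral cont_integral expdom \<sigma> (f k)) (linepath log_base S)" for k
    unfolding int
  proof (rule has_contour_integral_integral)
    show "f k contour_integrable_on linepath log_base S"
      unfolding f_def using seg halfplane_subset_expdom
      by (intro contour_integrable_holomorphic_simple[OF exp_kernel_holomorphic open_expdom])
         (auto simp: H_def)
  qed
  then have 1: "((\<lambda>s. \<Sum>i\<le>p. coef i * f (p - i) s) has_contour_integral
      (\<Sum>i\<le>p. coef i * cont_integral expdom \<sigma> (f (p - i)))) (linepath log_base S)"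
    by (intro has_contour_integral_sum has_contour_integral_lmul) auto
  define G where "G j s = exp (c * s) * lerch j (exp s) c" for j s
  \<comment> \<open>As a function of its centre, the Taylor sum is a primitive of the remainder
    kernel. At \<open>log_base\<close> it is the polynomial part of \<open>lifted\<close>, at
    \<open>S\<close> the series sought.\<close>
  define Q where "Q s = (\<Sum>j\<le>p. (S - s) ^ j / fact j * G (Suc p - j) s)" for s
  have Q': "(Q has_field_derivative (\<Sum>i\<le>p. coef i * f (p - i) s)) (at s within H)" if "s \<in> H" for s
  proof -
    have G': "(G (Suc j) has_field_derivative G j s) (at s)" for j
      unfolding G_def using that c by (intro lerch_has_derivative) (auto simp: H_def)
    have "Q = (\<lambda>s. \<Sum>j\<le>p. (S - s) ^ j / fact j * G (0 + Suc p - j) s)"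
      by (simp add: Q_def fun_eq_iff)
    then have "(Q has_field_derivative (S - s) ^ p / fact p * G 0 s) (at s)"
      using Taylor_sum_has_derivative[where G = G and s = s and q = 0 and p = p, OF G'] by simp
    \<comment> \<open>The binomial theorem reassembles the powers of \<open>S\<close> split off in
      \<open>lifted\<close>, and \<open>lerch 0\<close> is the geometric series.\<close>
    moreover have "(S - s) ^ p / fact p * G 0 s = (\<Sum>i\<le>p. coef i * f (p - i) s)"
    proof -
      have "G 0 s = exp (c * s) / (1 - exp s)"
        using that by (simp add: G_def lerch_0 H_def)
      moreover have "(S - s) ^ p = (\<Sum>i\<le>p. of_nat (p choose i) * S ^ i * (- s) ^ (p - i))"
        using binomial_ring[of S "- s" p] by simp
      ultimately show ?thesis
        by (simp add: coef_def f_def sum_distrib_left sum_distrib_right sum_divide_distrib mult_ac)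
    qed
    ultimately show ?thesis by (simp add: has_field_derivative_at_within)
  qed
  have "((\<lambda>s. \<Sum>i\<le>p. coef i * f (p - i) s) has_contour_integral (Q S - Q log_base))
      (linepath log_base S)"
    using contour_integral_primitive[OF Q', of "linepath log_base S"] seg by simp
  with 1 have I: "(\<Sum>i\<le>p. coef i * cont_integral expdom \<sigma> (f (p - i))) = Q S - Q log_base"
    by (rule has_contour_integral_unique)
  have QS: "Q S = G (Suc p) S"
  proof -
    have "Q S = (\<Sum>j\<le>p. if j = 0 then G (Suc p) S else 0)"
      unfolding Q_def by (intro sum.cong) auto
    then show ?thesis by simp
  qed
  have "lifted p \<sigma> c = exp ((1 - c) * S) * (Q log_base +
      (\<Sum>i\<le>p. coef i * cont_integral expdom \<sigma> (f (p - i))))"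
    unfolding lifted_def S_def[symmetric] Q_def G_def coef_def f_def exp_log_base
    by (simp add: sum_distrib_left mult_ac)
  also have "\<dots> = exp ((1 - c) * S) * G (Suc p) S"
    by (simp add: I QS)
  also have "\<dots> = exp S * lerch (Suc p) (exp S) c"
  proof -
    \<comment> \<open>The prefactor of \<open>lifted\<close> removes the twist
      \<open>exp (c * S)\<close> and supplies the factor \<open>z = exp S\<close> by which
      \<open>Li\<close> differs from \<open>lerch\<close>.\<close>
    have "exp ((1 - c) * S) * exp (c * S) = exp S"
      unfolding exp_add[symmetric] by (simp add: algebra_simps)
    then show ?thesis unfolding G_def by (simp add: mult.assoc[symmetric])
  qed
  also have "\<dots> = Li (Suc p) (exp S) c"
    using S by (simp add: Li_eq_lerch H_def)
  finally show ?thesis by (simp add: S_def)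
qed

section \<open>Descent to the universal cover\<close>

text \<open>Here \<open>p\<close> stands for \<open>m - 1\<close>. Asking for a homotopy between
  \<open>\<gamma>\<close> and \<open>exp \<circ> \<sigma>\<close> instead of equality lets any
  convenient lift evaluate the function.\<close>

definition continuation :: "nat \<Rightarrow> (real \<Rightarrow> complex) \<Rightarrow> complex \<Rightarrow> complex" where
  "continuation p \<gamma> = lifted p (SOME \<sigma>. path \<sigma> \<and> path_image \<sigma> \<subseteq> expdom \<and>
     pathstart \<sigma> = log_base \<and> homotopic_paths P01 \<gamma> (exp \<circ> \<sigma>))"

lemma log_lift_exists:
  assumes "\<gamma> \<in> cover_paths"
  obtains \<sigma> where "path \<sigma>" "path_image \<sigma> \<subseteq> expdom" "pathstart \<sigma> = log_base"
    "\<And>t. t \<in> {0..1} \<Longrightarrow> exp (\<sigma> t) = \<gamma> t" "homotopic_paths P01 \<gamma> (exp \<circ> \<sigma>)"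
proof -
  have \<gamma>: "path \<gamma>" "path_image \<gamma> \<subseteq> P01" "pathstart \<gamma> = exp log_base"
    using assms by (auto simp: cover_paths_def exp_log_base)
  have "log_base \<in> expdom"
    by (simp add: expdom_def exp_log_base base_pt_def)
  then obtain \<sigma> where \<sigma>: "path \<sigma>" "path_image \<sigma> \<subseteq> expdom" "pathstart \<sigma> = log_base"
      "\<And>t. t \<in> {0..1} \<Longrightarrow> exp (\<sigma> t) = \<gamma> t"
    using covering_space_lift_path_strong[OF covering_space_expdom _ \<gamma>] by blast
  moreover have "homotopic_paths P01 \<gamma> (exp \<circ> \<sigma>)"
    by (rule homotopic_paths_eq) (use \<gamma> \<sigma> in auto)
  ultimately show ?thesis using that by blast
qed

text \<open>Homotopic paths lift to homotopic paths once the starting points agree, so all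
  admissible choices give the same \<open>lifted\<close>.\<close>

lemma continuation_eq_lifted:
  assumes \<sigma>: "path \<sigma>" "path_image \<sigma> \<subseteq> expdom" "pathstart \<sigma> = log_base"
    and hom: "homotopic_paths P01 \<gamma> (exp \<circ> \<sigma>)"
  shows "continuation p \<gamma> = lifted p \<sigma>"
proof -
  define Q where "Q = (\<lambda>\<sigma>. path \<sigma> \<and> path_image \<sigma> \<subseteq> expdom \<and> pathstart \<sigma> = log_base \<and>
    homotopic_paths P01 \<gamma> (exp \<circ> \<sigma>))"
  have "Q \<sigma>" using assms by (simp add: Q_def)
  then have "Q (SOME \<sigma>. Q \<sigma>)" by (rule someI[where P = Q])
  then obtain \<tau> where \<tau>: "\<tau> = (SOME \<sigma>. Q \<sigma>)" "path \<tau>" "path_image \<tau> \<subseteq> expdom"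
      "pathstart \<tau> = log_base" "homotopic_paths P01 \<gamma> (exp \<circ> \<tau>)"
    unfolding Q_def by blast
  have hom': "homotopic_paths P01 (exp \<circ> \<tau>) (exp \<circ> \<sigma>)"
    using homotopic_paths_trans[OF homotopic_paths_sym[OF \<tau>(5)] hom] .
  have "homotopic_paths expdom \<tau> \<sigma>"
    by (rule covering_space_lift_homotopic_paths[OF covering_space_expdom _ _ _ _ hom'])
       (use \<tau> \<sigma> homotopic_paths_imp_path[OF hom'] homotopic_paths_imp_subset[OF hom'] in auto)
  from lifted_homotopic[OF this] show ?thesis
    unfolding continuation_def \<tau>(1) Q_def .
qed

lemma continuation_homotopic:
  assumes "\<gamma> \<in> cover_paths" "homotopic_paths P01 \<gamma> \<delta>"
  shows "continuation p \<gamma> = continuation p \<delta>"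
proof (rule log_lift_exists[OF assms(1)])
  fix \<sigma> assume \<sigma>: "path \<sigma>" "path_image \<sigma> \<subseteq> expdom" "pathstart \<sigma> = log_base"
    and hom: "homotopic_paths P01 \<gamma> (exp \<circ> \<sigma>)"
  have "homotopic_paths P01 \<delta> (exp \<circ> \<sigma>)"
    using homotopic_paths_trans[OF homotopic_paths_sym[OF assms(2)] hom] .
  from continuation_eq_lifted[OF \<sigma> this] continuation_eq_lifted[OF \<sigma> hom]
  show ?thesis by simp
qed

lemma continuation_eq_Li:
  assumes \<gamma>: "path \<gamma>" "path_image \<gamma> \<subseteq> ball 0 1 - {0}" "pathstart \<gamma> = base_pt" and c: "Re c > 0"
  shows "continuation p \<gamma> c = Li (Suc p) (pathfinish \<gamma>) c"
proof -
  have "\<gamma> \<in> cover_paths" using \<gamma> by (auto simp: cover_paths_def P01_def)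
  then obtain \<sigma> where \<sigma>: "path \<sigma>" "path_image \<sigma> \<subseteq> expdom" "pathstart \<sigma> = log_base"
      "\<And>t. t \<in> {0..1} \<Longrightarrow> exp (\<sigma> t) = \<gamma> t" "homotopic_paths P01 \<gamma> (exp \<circ> \<sigma>)"
    using log_lift_exists by blast
  \<comment> \<open>The norm of \<open>exp s\<close> is the real exponential of \<open>Re s\<close>,
    so the punctured unit disk lifts into the left half-plane.\<close>
  have "Re (\<sigma> t) < 0" if "t \<in> {0..1}" for t
  proof -
    have "norm (exp (\<sigma> t)) < 1"
      unfolding \<sigma>(4)[OF that] using \<gamma>(2) that by (force simp: path_image_def)
    then show ?thesis by simp
  qed
  then have "path_image \<sigma> \<subseteq> {s. Re s < 0}" by (auto simp: path_image_def)
  moreover have "pathfinish \<gamma> = exp (pathfinish \<sigma>)"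
    using \<sigma>(4)[of 1] by (simp add: pathfinish_def)
  ultimately show ?thesis
    using continuation_eq_lifted[OF \<sigma>(1-3,5)] lifted_halfplane[OF \<sigma>(1) _ \<sigma>(3) c] by simp
qed

section \<open>Logarithmic charts of the cover\<close>

text \<open>On a small disk a branch \<open>l\<close> of the logarithm turns the chart
  \<open>sheet\<close> into appending a segment to one fixed lift \<open>\<sigma>\<close>, so
  \<open>w\<close> enters only through the end point \<open>l w\<close>.\<close>

lemma continuation_sheet:
  assumes "\<gamma> \<in> cover_paths"
  obtains r \<sigma> D l where "r > 0" "ball (pathfinish \<gamma>) r \<subseteq> P01"
    "path \<sigma>" "path_image \<sigma> \<subseteq> expdom" "open D" "convex D" "D \<subseteq> expdom" "pathfinish \<sigma> \<in> D"
    "l holomorphic_on ball (pathfinish \<gamma>) r" "l ` ball (pathfinish \<gamma>) r \<subseteq> D"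
    "\<And>p w. w \<in> ball (pathfinish \<gamma>) r \<Longrightarrow>
       continuation p (sheet \<gamma> w) = lifted p (\<sigma> +++ linepath (pathfinish \<sigma>) (l w))"
proof -
  define z where "z = pathfinish \<gamma>"
  have \<gamma>: "path \<gamma>" "path_image \<gamma> \<subseteq> P01" "pathstart \<gamma> = base_pt"
    using assms by (auto simp: cover_paths_def)
  obtain \<sigma> where \<sigma>: "path \<sigma>" "path_image \<sigma> \<subseteq> expdom" "pathstart \<sigma> = log_base"
      "\<And>t. t \<in> {0..1} \<Longrightarrow> exp (\<sigma> t) = \<gamma> t" "homotopic_paths P01 \<gamma> (exp \<circ> \<sigma>)"
    using log_lift_exists[OF assms] by blast
  define S where "S = pathfinish \<sigma>"
  have expS: "exp S = z" using \<sigma>(4)[of 1] by (simp add: S_def z_def pathfinish_def)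
  have z: "z \<in> P01" "z \<noteq> 0"
    using \<gamma>(2) pathfinish_in_path_image[of \<gamma>] by (auto simp: z_def P01_def)
  have "open P01" unfolding P01_def by (simp add: open_Compl)
  then obtain r' where r': "r' > 0" "ball z r' \<subseteq> P01"
    using z open_contains_ball by blast
  have "isCont exp S" by simp
  then obtain \<rho> where \<rho>: "\<rho> > 0" "exp ` ball S \<rho> \<subseteq> ball z r'"
    using r'(1) unfolding continuous_at_ball expS by blast
  have D: "ball S \<rho> \<subseteq> expdom"
    using \<rho>(2) r'(2) by (auto simp: expdom_def P01_def)
  \<comment> \<open>Normalised so that \<open>l z = S\<close>. On the disk of radius
    \<open>norm z\<close> about \<open>z\<close> the quotient \<open>w / z\<close> has positive real
    part and stays off the branch cut.\<close>
  define l where "l w = S + Ln (w / z)" for w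
  have expl: "exp (l w) = w" if "w \<noteq> 0" for w
    using that z by (simp add: l_def exp_add expS)
  have Re_pos: "0 < Re (w / z)" if "w \<in> ball z (norm z)" for w
  proof -
    have "norm (1 - w / z) = norm (z - w) / norm z"
      using z by (simp add: norm_divide[symmetric] diff_divide_distrib)
    also have "\<dots> < 1" using that z by (simp add: dist_norm)
    finally show ?thesis using complex_Re_le_cmod[of "1 - w / z"] by simp
  qed
  have lhol: "l holomorphic_on ball z (norm z)"
    unfolding l_def
  proof (intro holomorphic_intros)
    fix w assume "w \<in> ball z (norm z)"
    then show "w / z \<notin> \<real>\<^sub>\<le>\<^sub>0" using Re_pos[of w] by (auto simp: complex_nonpos_Reals_iff)
  qed (use z in auto)
  then have "isCont l z"
    using z by (intro holomorphic_on_imp_differentiable_at[THEN field_differentiable_imp_continuous_at, of _ "ball z (norm z)"]) auto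
  moreover have "l z = S" using z by (simp add: l_def)
  ultimately obtain r1 where r1: "r1 > 0" "l ` ball z r1 \<subseteq> ball S \<rho>"
    using \<rho>(1) unfolding continuous_at_ball by metis
  \<comment> \<open>The three bounds ensure in turn that the disk avoids 0 and 1, that
    \<open>l\<close> maps it into \<open>ball S \<rho>\<close>, and that \<open>l\<close> is
    holomorphic on it.\<close>
  define r where "r = min (min r' r1) (norm z)"
  have r: "r > 0" "r \<le> r'" "r \<le> r1" "r \<le> norm z" using r' r1 z by (auto simp: r_def)
  have sub: "ball z r \<subseteq> ball z r'" "ball z r \<subseteq> ball z r1" "ball z r \<subseteq> ball z (norm z)"
    using r by (auto intro!: subset_ball)
  have eq: "continuation p (sheet \<gamma> w) = lifted p (\<sigma> +++ linepath (pathfinish \<sigma>) (l w))"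
    if w: "w \<in> ball z r" for p w
  proof (rule continuation_eq_lifted)
    have lw: "l w \<in> ball S \<rho>" using w sub(2) r1(2) by blast
    have w0: "w \<noteq> 0" using w r(4) by auto
    have seg: "closed_segment S (l w) \<subseteq> ball S \<rho>"
      using lw \<rho>(1) by (intro closed_segment_subset) auto
    show "path (\<sigma> +++ linepath (pathfinish \<sigma>) (l w))" using \<sigma> by simp
    show "path_image (\<sigma> +++ linepath (pathfinish \<sigma>) (l w)) \<subseteq> expdom"
      using \<sigma>(2) seg D by (intro subset_path_image_join) (auto simp: S_def)
    show "pathstart (\<sigma> +++ linepath (pathfinish \<sigma>) (l w)) = log_base" using \<sigma> by simp
    \<comment> \<open>The exponential of a segment is curved, but it shares the convex
      \<open>ball z r'\<close> with the straight segment.\<close>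
    have "homotopic_paths (ball z r') (linepath z w) (exp \<circ> linepath S (l w))"
    proof (rule homotopic_paths_convex)
      show "path (exp \<circ> linepath S (l w))"
        by (intro path_continuous_image) (auto intro!: continuous_intros)
      show "path_image (exp \<circ> linepath S (l w)) \<subseteq> ball z r'"
        using seg \<rho>(2) by (auto simp: path_image_compose)
      show "path_image (linepath z w) \<subseteq> ball z r'"
        unfolding path_image_linepath
        by (rule closed_segment_subset) (use w sub(1) r' in auto)
      show "pathstart (exp \<circ> linepath S (l w)) = pathstart (linepath z w)"
           "pathfinish (exp \<circ> linepath S (l w)) = pathfinish (linepath z w)"
        using expS expl[OF w0] by (auto simp: pathstart_compose pathfinish_compose)
    qed auto
    then have "homotopic_paths P01 (linepath z w) (exp \<circ> linepath S (l w))"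
      using r'(2) by (rule homotopic_paths_subset)
    then have "homotopic_paths P01 (\<gamma> +++ linepath z w) ((exp \<circ> \<sigma>) +++ (exp \<circ> linepath S (l w)))"
      using \<sigma>(5) by (intro homotopic_paths_join) (auto simp: z_def)
    then show "homotopic_paths P01 (sheet \<gamma> w) (exp \<circ> (\<sigma> +++ linepath (pathfinish \<sigma>) (l w)))"
      by (simp add: sheet_def z_def S_def path_compose_join)
  qed
  show ?thesis
  proof (rule that)
    show "r > 0" "path \<sigma>" "path_image \<sigma> \<subseteq> expdom" by fact+
    show "ball (pathfinish \<gamma>) r \<subseteq> P01" using sub r' by (auto simp: z_def)
    show "open (ball S \<rho>)" "convex (ball S \<rho>)" "ball S \<rho> \<subseteq> expdom" "pathfinish \<sigma> \<in> ball S \<rho>"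
      using D \<rho> by (auto simp: S_def)
    show "l holomorphic_on ball (pathfinish \<gamma>) r"
      using lhol sub(3) unfolding z_def by (rule holomorphic_on_subset)
    show "l ` ball (pathfinish \<gamma>) r \<subseteq> ball S \<rho>"
      using r1(2) sub(2) unfolding z_def by blast
  qed (use eq in \<open>auto simp: z_def\<close>)
qed

section \<open>Poles\<close>

lemma holomorphic2_cont_integral:
  assumes \<sigma>: "path \<sigma>" "path_image \<sigma> \<subseteq> expdom"
    and D: "open D" "convex D" "D \<subseteq> expdom" "pathfinish \<sigma> \<in> D"
  shows "holomorphic2 (\<lambda>(s, c). cont_integral expdom (\<sigma> +++ linepath (pathfinish \<sigma>) s)
           (\<lambda>s. (- s) ^ k / (1 - exp s) * exp (c * s))) (D \<times> UNIV)"
proof (rule holomorphic2_of_partials)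
  show "((\<lambda>s. cont_integral expdom (\<sigma> +++ linepath (pathfinish \<sigma>) s)
        (\<lambda>s. (- s) ^ k / (1 - exp s) * exp (c * s))) has_field_derivative
      (- s) ^ k / (1 - exp s) * exp (c * s)) (at s)" if "s \<in> D" for s c
    using cont_integral_join_linepath_has_derivative[OF open_expdom exp_kernel_holomorphic \<sigma> D that] .
  show "(\<lambda>c. cont_integral expdom (\<sigma> +++ linepath (pathfinish \<sigma>) s)
      (\<lambda>s. (- s) ^ k / (1 - exp s) * exp (c * s))) holomorphic_on UNIV" if "s \<in> D" for s
  proof (rule cont_integral_exp_kernel_holomorphic[OF open_expdom kernel_holomorphic])
    have "closed_segment (pathfinish \<sigma>) s \<subseteq> D"
      using D that by (simp add: closed_segment_subset)
    then show "path_image (\<sigma> +++ linepath (pathfinish \<sigma>) s) \<subseteq> expdom"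
      using \<sigma> D by (intro subset_path_image_join) auto
  qed (use \<sigma> in auto)
  show "continuous_on (D \<times> UNIV) (\<lambda>(s, c). (- s) ^ k / (1 - exp s) * exp (c * s))"
    using D(3) by (auto simp: case_prod_unfold expdom_def intro!: continuous_intros)
qed (use D in auto)

lemma holomorphic2_factor:
  "holomorphic2 (\<lambda>q. exp ((1 - snd q) * fst q)) U"
  "holomorphic2 (\<lambda>q. exp (snd q * log_base)) U"
  "holomorphic2 (\<lambda>q. (fst q - log_base) ^ j / fact j) U"
proof -
  have minus: "holomorphic2 (\<lambda>q. 1 - snd q) U"
    by (rule holomorphic2_compose[OF holomorphic2_snd, where g = "\<lambda>c. 1 - c"])
       (auto intro!: derivative_intros)
  show "holomorphic2 (\<lambda>q. exp ((1 - snd q) * fst q)) U"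
    by (rule holomorphic2_compose[OF holomorphic2_mult[OF minus holomorphic2_fst], where g = exp])
       (auto intro: field_differentiable_within_exp)
  show "holomorphic2 (\<lambda>q. exp (snd q * log_base)) U"
    by (rule holomorphic2_compose[OF holomorphic2_mult[OF holomorphic2_snd holomorphic2_const], where g = exp])
       (auto intro: field_differentiable_within_exp)
  have "(\<lambda>s. (s - log_base) ^ j / fact j) holomorphic_on UNIV"
    by (intro holomorphic_intros) auto
  then show "holomorphic2 (\<lambda>q. (fst q - log_base) ^ j / fact j) U"
    by (intro holomorphic2_compose[OF holomorphic2_fst, where g = "\<lambda>s. (s - log_base) ^ j / fact j"])
       (auto intro: holomorphic_on_imp_differentiable_at)
qed

context
  fixes \<sigma> :: "real \<Rightarrow> complex" and D :: "complex set" and p :: nat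
  assumes \<sigma>: "path \<sigma>" "path_image \<sigma> \<subseteq> expdom"
    and D: "open D" "convex D" "D \<subseteq> expdom" "pathfinish \<sigma> \<in> D"
begin

text \<open>The integrals are entire in \<open>c\<close>, so \<open>C\<close> may be any set of
  parameters, nonpositive integers included.\<close>

lemma holomorphic2_remainder:
  "holomorphic2 (\<lambda>q. \<Sum>i\<le>p. of_nat (p choose i) / fact p * fst q ^ i *
     cont_integral expdom (\<sigma> +++ linepath (pathfinish \<sigma>) (fst q))
       (\<lambda>s. (- s) ^ (p - i) / (1 - exp s) * exp (snd q * s))) (D \<times> C)"
proof (intro holomorphic2_sum holomorphic2_mult holomorphic2_const)
  fix i
  show "holomorphic2 (\<lambda>q. fst q ^ i) (D \<times> C)"
    by (rule holomorphic2_compose[OF holomorphic2_fst, where g = "\<lambda>s. s ^ i"])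
       (auto intro!: derivative_intros)
  show "holomorphic2 (\<lambda>q. cont_integral expdom (\<sigma> +++ linepath (pathfinish \<sigma>) (fst q))
      (\<lambda>s. (- s) ^ (p - i) / (1 - exp s) * exp (snd q * s))) (D \<times> C)"
    using holomorphic2_cont_integral[OF \<sigma> D, of "p - i"]
    by (auto simp: case_prod_unfold elim: holomorphic2_subset)
qed

lemma holomorphic2_lifted:
  "holomorphic2 (\<lambda>(s, c). lifted p (\<sigma> +++ linepath (pathfinish \<sigma>) s) c) (D \<times> - \<int>\<^sub>\<le>\<^sub>0)"
proof -
  have lerch: "holomorphic2 (\<lambda>q. lerch (Suc p - j) base_pt (snd q)) (D \<times> - \<int>\<^sub>\<le>\<^sub>0)" for j
    by (rule holomorphic2_compose[OF holomorphic2_snd, where g = "lerch (Suc p - j) base_pt"])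
       (auto intro!: holomorphic_on_imp_differentiable_at[OF lerch_holomorphic[OF base_pt_norm]]
          simp: open_Compl)
  show ?thesis
    unfolding lifted_def case_prod_unfold pathfinish_join pathfinish_linepath
    by (rule holomorphic2_remainder holomorphic2_factor lerch
        holomorphic2_mult holomorphic2_add holomorphic2_sum)+
qed

text \<open>The factor \<open>(c + n) ^ Suc p\<close> clears all poles at \<open>- n\<close>. At
  \<open>c = - n\<close> only the principal part of \<open>lerch (Suc p)\<close> survives: a power
  of \<open>base_pt\<close> times exponentials, nonzero for every end point \<open>s\<close>, so the
  order cannot drop.\<close>

lemma lifted_pole:
  obtains G where "holomorphic2 G (D \<times> ball (- of_nat n) 1)"
    "\<And>s c. c \<noteq> - of_nat n \<Longrightarrow>
       lifted p (\<sigma> +++ linepath (pathfinish \<sigma>) s) c = G (s, c) / (c + of_nat n) ^ Suc p"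
    "\<And>s. G (s, - of_nat n) \<noteq> 0"
proof -
  have "\<exists>R. R holomorphic_on ball (- of_nat n) 1 \<and>
      (\<forall>c. lerch j base_pt c = base_pt ^ n / (c + of_nat n) ^ j + R c)" for j
    using lerch_principal_part[OF base_pt_norm] by metis
  then obtain R where R: "\<And>j. R j holomorphic_on ball (- of_nat n) 1"
      "\<And>j c. lerch j base_pt c = base_pt ^ n / (c + of_nat n) ^ j + R j c"
    by metis
  define J where "J q = (\<Sum>i\<le>p. of_nat (p choose i) / fact p * fst q ^ i *
     cont_integral expdom (\<sigma> +++ linepath (pathfinish \<sigma>) (fst q))
       (\<lambda>s. (- s) ^ (p - i) / (1 - exp s) * exp (snd q * s)))" for q
  \<comment> \<open>This is \<open>(c + n) ^ Suc p\<close> times \<open>lifted\<close> with the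
    principal parts inserted. Their quotients are written as powers \<open>(c + n) ^ j\<close>, so
    \<open>G\<close> is holomorphic at \<open>c = - n\<close> as well.\<close>
  define G where "G q = exp ((1 - snd q) * fst q) *
     (exp (snd q * log_base) * (\<Sum>j\<le>p. (fst q - log_base) ^ j / fact j *
        (base_pt ^ n * (snd q + of_nat n) ^ j + (snd q + of_nat n) ^ Suc p * R (Suc p - j) (snd q))) +
      (snd q + of_nat n) ^ Suc p * J q)" for q
  have pow: "holomorphic2 (\<lambda>q. (snd q + of_nat n) ^ k) U" for k U
    by (rule holomorphic2_compose[OF holomorphic2_snd, where g = "\<lambda>c. (c + of_nat n) ^ k"])
       (auto intro!: derivative_intros)
  show ?thesis
  proof
    have "holomorphic2 (\<lambda>q. R j (snd q)) (D \<times> ball (- of_nat n) 1)" for j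
      by (rule holomorphic2_compose[OF holomorphic2_snd, where g = "R j"])
         (auto intro!: holomorphic_on_imp_differentiable_at[OF R(1)])
    note rules = holomorphic2_remainder holomorphic2_factor this pow holomorphic2_const
      holomorphic2_mult holomorphic2_add holomorphic2_sum
    show "holomorphic2 G (D \<times> ball (- of_nat n) 1)"
      unfolding G_def[abs_def] J_def by (rule rules)+
    show "lifted p (\<sigma> +++ linepath (pathfinish \<sigma>) s) c = G (s, c) / (c + of_nat n) ^ Suc p"
      if c: "c \<noteq> - of_nat n" for s c
    proof -
      have nz: "c + of_nat n \<noteq> 0" using c by (simp add: eq_neg_iff_add_eq_0)
      have "(c + of_nat n) ^ Suc p * lerch (Suc p - j) base_pt c =
          base_pt ^ n * (c + of_nat n) ^ j + (c + of_nat n) ^ Suc p * R (Suc p - j) c" if "j \<le> p" for j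
      proof -
        have "(c + of_nat n) ^ Suc p = (c + of_nat n) ^ j * (c + of_nat n) ^ (Suc p - j)"
          using that by (simp flip: power_add)
        then show ?thesis using nz by (simp add: R(2) algebra_simps)
      qed
      then have "G (s, c) = exp ((1 - c) * s) *
         (exp (c * log_base) * (\<Sum>j\<le>p. (s - log_base) ^ j / fact j *
            ((c + of_nat n) ^ Suc p * lerch (Suc p - j) base_pt c)) +
          (c + of_nat n) ^ Suc p * J (s, c))"
        by (simp add: G_def)
      also have "\<dots> = (c + of_nat n) ^ Suc p * (exp ((1 - c) * s) *
         (exp (c * log_base) * (\<Sum>j\<le>p. (s - log_base) ^ j / fact j *
            lerch (Suc p - j) base_pt c) + J (s, c)))"
        by (simp only: sum_distrib_left distrib_left mult_ac)
      also have "\<dots> = (c + of_nat n) ^ Suc p * lifted p (\<sigma> +++ linepath (pathfinish \<sigma>) s) c"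
        by (simp only: lifted_def J_def pathfinish_join pathfinish_linepath fst_conv snd_conv)
      finally show ?thesis using nz by simp
    qed
    show "G (s, - of_nat n) \<noteq> 0" for s
    proof -
      have "(\<Sum>j\<le>p. (s - log_base) ^ j / fact j * (base_pt ^ n * 0 ^ j)) = base_pt ^ n"
      proof -
        have "(\<Sum>j\<le>p. (s - log_base) ^ j / fact j * (base_pt ^ n * 0 ^ j)) =
            (\<Sum>j\<le>p. if j = 0 then base_pt ^ n else 0)"
          by (intro sum.cong) auto
        then show ?thesis by simp
      qed
      then have "G (s, - of_nat n) = exp ((1 + of_nat n) * s) * (exp (- of_nat n * log_base) * base_pt ^ n)"
        by (simp add: G_def)
      then show ?thesis by (simp add: base_pt_def)
    qed
  qed
qed

end

section \<open>Meromorphy and exact pole orders\<close>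

text \<open>The local denominator is 1 away from \<open>Z\<close> and \<open>(c - a) ^ Suc k\<close>
  near \<open>a\<close> in \<open>Z\<close>. The quotient has to match \<open>f\<close> only where
  the denominator is nonzero, so values on the polar set do not matter.\<close>

lemma meromorphic2_of_poles:
  assumes B: "open B" "connected B" and Z: "closed Z"
    and hol: "holomorphic2 f (B \<times> (- Z))"
    and pole: "\<And>a. a \<in> Z \<Longrightarrow> \<exists>G. holomorphic2 G (B \<times> ball a 1) \<and>
       (\<forall>w\<in>B. \<forall>c\<in>ball a 1. c \<noteq> a \<longrightarrow> f (w, c) = G (w, c) / (c - a) ^ Suc k)"
  shows "meromorphic2 f (B \<times> UNIV)"
  unfolding meromorphic2_def
proof (intro conjI ballI)
  show "open (B \<times> (UNIV :: complex set))" using B by (simp add: open_Times)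
  fix q assume "q \<in> B \<times> (UNIV :: complex set)"
  then obtain w c where q: "q = (w, c)" "w \<in> B" by auto
  show "\<exists>N g h. open N \<and> connected N \<and> q \<in> N \<and> N \<subseteq> B \<times> UNIV \<and> holomorphic2 g N \<and>
      holomorphic2 h N \<and> (\<exists>q\<in>N. h q \<noteq> 0) \<and> (\<forall>q\<in>N. h q \<noteq> 0 \<longrightarrow> f q = g q / h q)"
  proof (cases "c \<in> Z")
    case False
    then obtain e where e: "e > 0" "ball c e \<subseteq> - Z"
      using Z open_contains_ball[of "- Z"] by (auto simp: open_Compl)
    show ?thesis
    proof (intro exI conjI)
      show "open (B \<times> ball c e)" "connected (B \<times> ball c e)"
        using B by (auto simp: open_Times connected_Times)
      show "q \<in> B \<times> ball c e" using q e by simp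
      show "holomorphic2 f (B \<times> ball c e)"
        using hol by (rule holomorphic2_subset) (use e(2) in auto)
      show "holomorphic2 (\<lambda>_. 1) (B \<times> ball c e)" by (rule holomorphic2_const)
      show "\<exists>q\<in>B \<times> ball c e. (1::complex) \<noteq> 0" using q e by (intro bexI[of _ q]) auto
    qed auto
  next
    case True
    from pole[OF this] obtain G where G: "holomorphic2 G (B \<times> ball c 1)"
       "\<forall>w\<in>B. \<forall>c'\<in>ball c 1. c' \<noteq> c \<longrightarrow> f (w, c') = G (w, c') / (c' - c) ^ Suc k"
      by blast
    show ?thesis
    proof (intro exI conjI)
      show "open (B \<times> ball c 1)" "connected (B \<times> ball c 1)"
        using B by (auto simp: open_Times connected_Times)
      show "q \<in> B \<times> ball c 1" using q by simp
      show "holomorphic2 G (B \<times> ball c 1)" by fact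
      show "holomorphic2 (\<lambda>q. (snd q - c) ^ Suc k) (B \<times> ball c 1)"
        by (rule holomorphic2_compose[OF holomorphic2_snd, where g = "\<lambda>x. (x - c) ^ Suc k"])
           (auto intro!: derivative_intros simp del: power_Suc)
      show "\<exists>q\<in>B \<times> ball c 1. (snd q - c) ^ Suc k \<noteq> 0"
        using q by (intro bexI[of _ "(w, c + 1 / 2)"]) (auto simp: dist_norm norm_divide)
      show "\<forall>q\<in>B \<times> ball c 1. (snd q - c) ^ Suc k \<noteq> 0 \<longrightarrow> f q = G q / (snd q - c) ^ Suc k"
        using G(2) by auto
    qed auto
  qed
qed

text \<open>A numerator not vanishing at \<open>z\<close> fixes the order exactly. All three
  conclusions depend only on punctured neighbourhoods, so the value \<open>f z\<close> is
  free.\<close>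

lemma zorder_pole_of_factorisation:
  assumes "open S" "z \<in> S" "g holomorphic_on S" "g z \<noteq> 0"
    and eq: "\<And>c. c \<in> S \<Longrightarrow> c \<noteq> z \<Longrightarrow> f c = g c / (c - z) ^ Suc k"
  shows "is_pole f z" "zorder f z = - int (Suc k)" "f meromorphic_on {z}"
proof -
  have ev: "eventually (\<lambda>c. f c = g c / (c - z) ^ Suc k) (at z)"
    unfolding eventually_at_topological using assms(1,2) eq by blast
  have "is_pole (\<lambda>c. g c / (c - z) ^ Suc k) z"
    using assms by (intro is_pole_basic[of g S]) auto
  then show "is_pole f z"
    using is_pole_cong[OF ev refl] by simp
  show "zorder f z = - int (Suc k)"
  proof (rule zorder_eqI[OF assms(1-4)])
    fix w assume "w \<in> S" "w \<noteq> z"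
    then show "f w = g w * (w - z) powi (- int (Suc k))"
      unfolding power_int_minus power_int_of_nat divide_inverse[symmetric] by (rule eq)
  qed
  have "g analytic_on {z}"
    using assms(1-3) analytic_at by blast
  then have "(\<lambda>c. g c / (c - z) ^ Suc k) meromorphic_on {z}"
    by (intro meromorphic_intros analytic_on_imp_meromorphic_on) auto
  then show "f meromorphic_on {z}"
    using meromorphic_on_cong[of "{z}" f "\<lambda>c. g c / (c - z) ^ Suc k", OF _ refl] ev by simp
qed

text \<open>Substituting \<open>l w\<close> for the end point carries holomorphy and the pole
  factorisation from \<open>D\<close> to a disk in \<open>w\<close>, with the numerator still
  nonzero at \<open>- n\<close>.\<close>

lemma continuation_local_structure:
  assumes \<gamma>: "\<gamma> \<in> cover_paths"
  obtains r where "r > 0" "ball (pathfinish \<gamma>) r \<subseteq> P01"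
    "holomorphic2 (\<lambda>(w, c). continuation p (sheet \<gamma> w) c) (ball (pathfinish \<gamma>) r \<times> - \<int>\<^sub>\<le>\<^sub>0)"
    "\<And>n. \<exists>G. holomorphic2 G (ball (pathfinish \<gamma>) r \<times> ball (- of_nat n) 1) \<and>
       (\<forall>w\<in>ball (pathfinish \<gamma>) r. \<forall>c. c \<noteq> - of_nat n \<longrightarrow>
          continuation p (sheet \<gamma> w) c = G (w, c) / (c - (- of_nat n)) ^ Suc p) \<and>
       (\<forall>w. G (w, - of_nat n) \<noteq> 0)"
proof -
  obtain r \<sigma> D l where r: "r > 0" "ball (pathfinish \<gamma>) r \<subseteq> P01"
    and \<sigma>D: "path \<sigma>" "path_image \<sigma> \<subseteq> expdom" "open D" "convex D" "D \<subseteq> expdom" "pathfinish \<sigma> \<in> D"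
    and l: "l holomorphic_on ball (pathfinish \<gamma>) r" "l ` ball (pathfinish \<gamma>) r \<subseteq> D"
    and eq: "\<And>p w. w \<in> ball (pathfinish \<gamma>) r \<Longrightarrow>
       continuation p (sheet \<gamma> w) = lifted p (\<sigma> +++ linepath (pathfinish \<sigma>) (l w))"
    using continuation_sheet[OF \<gamma>] by blast
  define B where "B = ball (pathfinish \<gamma>) r"
  show ?thesis
  proof (rule that[OF r])
    have "holomorphic2 (\<lambda>(w, c). (\<lambda>(s, c). lifted p (\<sigma> +++ linepath (pathfinish \<sigma>) s) c) (l w, c))
        (B \<times> - \<int>\<^sub>\<le>\<^sub>0)"
      using holomorphic2_compose_fst[OF holomorphic2_lifted[OF \<sigma>D] l(1) _ l(2)] by (simp add: B_def)
    then show "holomorphic2 (\<lambda>(w, c). continuation p (sheet \<gamma> w) c)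
        (ball (pathfinish \<gamma>) r \<times> - \<int>\<^sub>\<le>\<^sub>0)"
      unfolding B_def[symmetric]
      by (rule holomorphic2_transform) (auto simp: B_def eq open_Times open_Compl)
    fix n
    obtain G where G: "holomorphic2 G (D \<times> ball (- of_nat n) 1)"
        "\<And>s c. c \<noteq> - of_nat n \<Longrightarrow>
          lifted p (\<sigma> +++ linepath (pathfinish \<sigma>) s) c = G (s, c) / (c + of_nat n) ^ Suc p"
        "\<And>s. G (s, - of_nat n) \<noteq> 0"
      using lifted_pole[OF \<sigma>D, of n p] by blast
    have "holomorphic2 (\<lambda>(w, c). G (l w, c)) (B \<times> ball (- of_nat n) 1)"
      using holomorphic2_compose_fst[OF G(1) l(1) _ l(2)] by (simp add: B_def)
    then show "\<exists>G. holomorphic2 G (ball (pathfinish \<gamma>) r \<times> ball (- of_nat n) 1) \<and>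
       (\<forall>w\<in>ball (pathfinish \<gamma>) r. \<forall>c. c \<noteq> - of_nat n \<longrightarrow>
          continuation p (sheet \<gamma> w) c = G (w, c) / (c - (- of_nat n)) ^ Suc p) \<and>
       (\<forall>w. G (w, - of_nat n) \<noteq> 0)"
      using G(2,3) by (intro exI[of _ "\<lambda>(w, c). G (l w, c)"]) (auto simp: B_def eq)
  qed
qed

text \<open>The segment appended at the chart centre is constant, so the point of the cover is
  unchanged; this ties the two-variable statements to \<open>\<gamma>\<close> itself.\<close>

lemma continuation_sheet_self:
  assumes "\<gamma> \<in> cover_paths"
  shows "continuation p (sheet \<gamma> (pathfinish \<gamma>)) = continuation p \<gamma>"
proof (rule continuation_homotopic[OF assms, symmetric])
  show "homotopic_paths P01 \<gamma> (sheet \<gamma> (pathfinish \<gamma>))"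
    unfolding sheet_def using assms
    by (intro homotopic_paths_sym[OF homotopic_paths_rid]) (auto simp: cover_paths_def)
qed

lemma continuation_meromorphic2:
  assumes \<gamma>: "\<gamma> \<in> cover_paths"
  shows "\<exists>r>0. ball (pathfinish \<gamma>) r \<subseteq> P01 \<and>
    meromorphic2 (\<lambda>(w, c). continuation p (sheet \<gamma> w) c) (ball (pathfinish \<gamma>) r \<times> UNIV) \<and>
    holomorphic2 (\<lambda>(w, c). continuation p (sheet \<gamma> w) c) (ball (pathfinish \<gamma>) r \<times> (- \<int>\<^sub>\<le>\<^sub>0))"
proof (rule continuation_local_structure[OF \<gamma>, of p], intro exI conjI)
  fix r
  assume hol: "holomorphic2 (\<lambda>(w, c). continuation p (sheet \<gamma> w) c)
      (ball (pathfinish \<gamma>) r \<times> - \<int>\<^sub>\<le>\<^sub>0)"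
    and pole: "\<And>n. \<exists>G. holomorphic2 G (ball (pathfinish \<gamma>) r \<times> ball (- of_nat n) 1) \<and>
       (\<forall>w\<in>ball (pathfinish \<gamma>) r. \<forall>c. c \<noteq> - of_nat n \<longrightarrow>
          continuation p (sheet \<gamma> w) c = G (w, c) / (c - (- of_nat n)) ^ Suc p) \<and>
       (\<forall>w. G (w, - of_nat n) \<noteq> 0)"
  show "meromorphic2 (\<lambda>(w, c). continuation p (sheet \<gamma> w) c) (ball (pathfinish \<gamma>) r \<times> UNIV)"
  proof (rule meromorphic2_of_poles[OF _ _ _ hol, where k = p])
    fix a :: complex assume "a \<in> \<int>\<^sub>\<le>\<^sub>0"
    then obtain n where a: "a = - of_nat n" by (elim nonpos_Ints_cases')
    show "\<exists>G. holomorphic2 G (ball (pathfinish \<gamma>) r \<times> ball a 1) \<and>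
        (\<forall>w\<in>ball (pathfinish \<gamma>) r. \<forall>c\<in>ball a 1. c \<noteq> a \<longrightarrow>
          (case (w, c) of (w, c) \<Rightarrow> continuation p (sheet \<gamma> w) c) = G (w, c) / (c - a) ^ Suc p)"
      using pole[of n] unfolding a prod.case by blast
  qed auto
qed

text \<open>Freezing \<open>w\<close> at the chart centre reduces everything to one variable; the
  nonvanishing numerator on that slice gives the exact order.\<close>

lemma continuation_meromorphic:
  assumes \<gamma>: "\<gamma> \<in> cover_paths"
  shows "continuation p \<gamma> meromorphic_on UNIV" "continuation p \<gamma> holomorphic_on (- \<int>\<^sub>\<le>\<^sub>0)"
    "is_pole (continuation p \<gamma>) (- of_nat n)"
    "zorder (continuation p \<gamma>) (- of_nat n) = - int (Suc p)"
proof -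
  define z where "z = pathfinish \<gamma>"
  obtain r where r: "r > 0" and "ball z r \<subseteq> P01"
    and hol: "holomorphic2 (\<lambda>(w, c). continuation p (sheet \<gamma> w) c) (ball z r \<times> - \<int>\<^sub>\<le>\<^sub>0)"
    and pole: "\<And>n. \<exists>G. holomorphic2 G (ball z r \<times> ball (- of_nat n) 1) \<and>
       (\<forall>w\<in>ball z r. \<forall>c. c \<noteq> - of_nat n \<longrightarrow>
          continuation p (sheet \<gamma> w) c = G (w, c) / (c - (- of_nat n)) ^ Suc p) \<and>
       (\<forall>w. G (w, - of_nat n) \<noteq> 0)"
    by (rule continuation_local_structure[OF \<gamma>, of p, folded z_def]) (rule that)
  have "holomorphic2 (\<lambda>(w, c). continuation p (sheet \<gamma> w) c) ({z} \<times> - \<int>\<^sub>\<le>\<^sub>0)"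
    using hol by (rule holomorphic2_subset) (use r in auto)
  from holomorphic2_imp_holomorphic_snd[OF this]
  show hol1: "continuation p \<gamma> holomorphic_on (- \<int>\<^sub>\<le>\<^sub>0)"
    by (simp add: z_def continuation_sheet_self[OF \<gamma>])
  have at_pole: "is_pole (continuation p \<gamma>) (- of_nat n) \<and>
      zorder (continuation p \<gamma>) (- of_nat n) = - int (Suc p) \<and>
      continuation p \<gamma> meromorphic_on {- of_nat n}" for n
  proof -
    obtain G where G: "holomorphic2 G (ball z r \<times> ball (- of_nat n) 1)"
       "\<forall>w\<in>ball z r. \<forall>c. c \<noteq> - of_nat n \<longrightarrow>
          continuation p (sheet \<gamma> w) c = G (w, c) / (c - (- of_nat n)) ^ Suc p"
       "\<forall>w. G (w, - of_nat n) \<noteq> 0"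
      using pole by blast
    have "holomorphic2 G ({z} \<times> ball (- of_nat n) 1)"
      using G(1) by (rule holomorphic2_subset) (use r in auto)
    then have "(\<lambda>c. G (z, c)) holomorphic_on ball (- of_nat n) 1"
      by (rule holomorphic2_imp_holomorphic_snd)
    moreover have "continuation p \<gamma> c = G (z, c) / (c - (- of_nat n)) ^ Suc p" if "c \<noteq> - of_nat n" for c
      using G(2)[rule_format, of z, OF _ that] r continuation_sheet_self[OF \<gamma>] by (simp add: z_def)
    ultimately show ?thesis
      using zorder_pole_of_factorisation[of "ball (- of_nat n) 1" "- of_nat n" "\<lambda>c. G (z, c)"
          "continuation p \<gamma>" p] G(3) by simp
  qed
  then show "is_pole (continuation p \<gamma>) (- of_nat n)"
    "zorder (continuation p \<gamma>) (- of_nat n) = - int (Suc p)" by auto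
  have "continuation p \<gamma> meromorphic_on {c}" for c
  proof (cases "c \<in> \<int>\<^sub>\<le>\<^sub>0")
    case True
    then obtain n where "c = - of_nat n" by (elim nonpos_Ints_cases')
    then show ?thesis using at_pole[of n] by simp
  next
    case False
    have "continuation p \<gamma> analytic_on (- \<int>\<^sub>\<le>\<^sub>0)"
      using hol1 by (simp add: analytic_on_open open_Compl)
    then show ?thesis
      using False by (intro analytic_on_imp_meromorphic_on) (auto elim: analytic_on_subset)
  qed
  then show "continuation p \<gamma> meromorphic_on UNIV"
    by (subst meromorphic_on_meromorphic_at) auto
qed

theorem theorem7p1:
  fixes m :: nat
  assumes "m \<ge> 1"
  shows "\<exists>F :: (real \<Rightarrow> complex) \<Rightarrow> complex \<Rightarrow> complex.
    \<comment> \<open>F is a well-defined function on (universal cover) x C\<close>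
    (\<forall>\<gamma>\<in>cover_paths. \<forall>\<delta>. homotopic_paths P01 \<gamma> \<delta> \<longrightarrow> F \<gamma> = F \<delta>) \<and>
    \<comment> \<open>F continues the series from the sheet over the punctured unit disk\<close>
    (\<forall>\<gamma>. path \<gamma> \<and> path_image \<gamma> \<subseteq> ball 0 1 - {0} \<and> pathstart \<gamma> = base_pt \<longrightarrow>
        (\<forall>c. Re c > 0 \<longrightarrow> F \<gamma> c = Li m (pathfinish \<gamma>) c)) \<and>
    \<comment> \<open>F is meromorphic in (z, c) on (universal cover) x C, holomorphic off c in Z_{<=0}\<close>
    (\<forall>\<gamma>\<in>cover_paths. \<exists>r>0. ball (pathfinish \<gamma>) r \<subseteq> P01 \<and>
        meromorphic2 (\<lambda>(w, c). F (sheet \<gamma> w) c) (ball (pathfinish \<gamma>) r \<times> UNIV) \<and>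
        holomorphic2 (\<lambda>(w, c). F (sheet \<gamma> w) c) (ball (pathfinish \<gamma>) r \<times> (- \<int>\<^sub>\<le>\<^sub>0))) \<and>
    \<comment> \<open>for fixed point of the cover: meromorphic in c, singularities exactly poles of order m at Z_{<=0}\<close>
    (\<forall>\<gamma>\<in>cover_paths.
        F \<gamma> meromorphic_on UNIV \<and>
        F \<gamma> holomorphic_on (- \<int>\<^sub>\<le>\<^sub>0) \<and>
        (\<forall>n::nat. is_pole (F \<gamma>) (- of_nat n) \<and> zorder (F \<gamma>) (- of_nat n) = - int m))"
proof -
  \<comment> \<open>Positivity of \<open>m\<close> provides the exponent \<open>p = m - 1\<close> of
    the remainder kernel.\<close>
  obtain p where m: "m = Suc p" using assms by (cases m) auto
  show ?thesis
    unfolding m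
    by (intro exI[of _ "continuation p"] conjI ballI allI impI)
       (simp_all add: continuation_homotopic continuation_eq_Li continuation_meromorphic2
         continuation_meromorphic del: of_nat_Suc)
qed

end
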